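(* Suppose: (i) every $f_i$ is convex ($\mu=0$) and $L$-smooth, i.e. $\langle\nabla f_i(x)-\nabla f_i(x'),x-x'\rangle\ge0$ and $\|\nabla f_i(x)-\nabla f_i(x')\|\le L\|x-x'\|$ for all $x,x'\in\mathbb{R}^d$; (ii) there are positive constants $\sigma^*,\zeta^*$ with $\frac1M\sum_{i=1}^n\sum_{j=1}^m\|\nabla f_{ij}(x^* )-\nabla f_i(x^* )\|^2\le\sigma^*$ and $\frac1n\sum_{i=1}^n\|\nabla f_i(x^* )\|^2\le\zeta^*$; (iii) for all $i$ and all $x,x'\in\mathbb{R}^d$, $\frac1m\sum_{j=1}^m\|\nabla f_{ij}(x)-\nabla f_{ij}(x')\|^2\le 2L\big(f_i(x)-f_i(x')-\langle\nabla f_i(x'),x-x'\rangle\big)$; (iv) at each iteration $k\ge0$ each device independently selects $b_k$ of its $m$ samples uniformly at random without replacement; (v) the non-negative matrices $W_k,G_k,V_k$ are independently and randomly chosen with $W_k\in\{W,\mathbf J_n\}$, $G_k\in\{\mathbf I_n,W_k\}$, $V_k\in\{\mathbf I_m,\mathbf J_m\}$ for all $k\ge 0$, $W_k$ is doubly stochastic, and $\rho_{r,W}:=\mathbb{E}\|W_k-\mathbf J_n\|_2^2=(1-r)\rho_W<1$, where $\rho_W:=\|W-\mathbf J_n\|_2^2$. Consider the SPP iteration with $C_k=W_k\otimes\mathbf J_m$ for all $k$ (i.e. $G_k=W_k$, $V_k=\mathbf J_m$), and assume $\rho_{r,W}>0$. In the Lyapunov function $T_k$ take $c_0=1$, $c_1=\frac{1-\rho_{r,W}}{n\rho_{r,W}(1+\rho_{r,W})}$,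 $c_2=0$, $c_3=\frac{20\alpha^2}{Mq(1-\rho_{r,W})^2}$, $c_4=\frac{8\alpha^2}{n(1-\rho_{r,W})}$, and let the step-size satisfy $$0<\alpha\le\min\Big\{\frac1{8L},\ \frac{1-\rho_{r,W}}{4L\sqrt{2\rho_{r,W}(1+\rho_{r,W})}},\ \frac{(1-\rho_{r,W})^2}{1056L}\Big\}.$$ Then for every integer $K\ge1$ $$\frac1K\sum_{k=0}^{K-1}\mathbb{E}[f(\bar x_k)-f(x^* )]\le\frac{(1-\rho_{r,W})^2}{2\alpha\big((1-\rho_{r,W})^2-(640+10(1-\rho_{r,W})^2)\alpha L\big)K}\,\mathbb{E}[T_0].$$
   Context: There are $n$ devices with $m$ samples each, $M=nm$. The functions $f_{ij}:\mathbb{R}^d\to\mathbb{R}$ ($1\le i\le n$, $1\le j\le m$) are differentiable, $f_i=\frac1m\sum_{j}f_{ij}$, $f=\frac1n\sum_i f_i$, and $x^*\in\arg\min f$ (written as a row vector when stacked). $\mathbf 1_s$ is the all-ones vector in $\mathbb{R}^s$, $\mathbf I_s$ the identity, $\mathbf J_s=\frac1s\mathbf 1_s\mathbf 1_s^T$, $\otimes$ the Kronecker product, $\|\cdot\|$ the Euclidean/Frobenius norm, $\|\cdot\|_2$ the spectral norm. Index $l=(i-1)m+j$ corresponds to sample $j$ of device $i$, and for $X\in\mathbb{R}^{M\times d}$ with rows $x_1,\dots,x_M$, $\nabla F(X)\in\mathbb{R}^{M\times d}$ has $l$-th row $\nabla f_{ij}(x_l)^T$. SPP iteration (constant step-size $\alpha>0$):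 $$X_{k+1}=R_kX_k-\alpha\Gamma_kY_k,\qquad Y_{k+1}=C_kY_k+\nabla F(X_{k+1})-\nabla F(X_k),$$ with $X_k,Y_k\in\mathbb{R}^{M\times d}$, $\Gamma_k=\Lambda_{k+1}(W_k\otimes\mathbf 1_m\mathbf 1_m^T)\frac{\Lambda_k}{b_k}$, $R_k=\mathbf I_M-\Lambda_{k+1}+\Gamma_k$, $C_k=G_k\otimes V_k$ ($W_k,G_k\in\mathbb{R}^{n\times n}$, $V_k\in\mathbb{R}^{m\times m}$). $\Lambda_k$ is the $M\times M$ diagonal $0/1$ matrix whose ones mark the samples selected at iteration $k$; each device selects exactly $b_k\in\{1,\dots,m\}$ of its samples. Initialization: $X_0=\mathbf 1_Mx_0$, $Y_0=\nabla F(X_0)$, $x_0$ deterministic. Set $S_k=(\mathbf I_n\otimes\mathbf 1_m^T)\frac{\Lambda_k}{b_k}\in\mathbb{R}^{n\times M}$, $\hat X_k=S_kX_k$, $\hat Y_k=S_kY_k$, $\bar x_k=\frac{\mathbf 1_n^T}{n}\hat X_k$, $\bar y_k=\frac{\mathbf 1_n^T}{n}\hat Y_k$. The following do not depend on $k$: $r:=P(W_k=\mathbf J_n)$, $q:=\mathbb{E}[b_k/m\mid V_k=\mathbf J_m]$. Lyapunov function (only the terms with nonzero coefficient here): for $k\ge0$, $T_{k+1}=c_0\|\bar x_{k+1}-x^*\|^2+c_1\|\hat X_{k+1}-\mathbf 1_n\bar x_{k+1}\|^2+c_3\|\nabla F(X_k)-\nabla F(\mathbf 1_Mx^* )\|^2+c_4\|\hat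 Y_{k+1}-\mathbf 1_n\bar y_{k+1}\|^2$; $T_0$ is given by the same formula with $X_{-1}:=X_0$. *)

theory Defs
  imports "HOL-Probability.Probability"
begin

definition gradient :: "('a::real_inner \<Rightarrow> real) \<Rightarrow> 'a \<Rightarrow> 'a" where
  "gradient f x = (THE D. GDERIV f x :> D)"

definition spectral_norm :: "real^'n^'m \<Rightarrow> real" where
  "spectral_norm A = onorm (\<lambda>x. A *v x)"

definition nonneg_mat :: "real^'n^'m \<Rightarrow> bool" where
  "nonneg_mat A \<longleftrightarrow> (\<forall>i j. 0 \<le> A $ i $ j)"

definition doubly_stochastic :: "real^'n^'n \<Rightarrow> bool" where
  "doubly_stochastic A \<longleftrightarrow> nonneg_mat A \<and>
     (\<forall>i. (\<Sum>j\<in>UNIV. A $ i $ j) = 1) \<and> (\<forall>j. (\<Sum>i\<in>UNIV. A $ i $ j) = 1)"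

definition ones_mat :: "real^'n^'m" where
  "ones_mat = (\<chi> i j. 1)"

definition avg_mat :: "real^'n^'n" where
  "avg_mat = (1 / real CARD('n)) *\<^sub>R ones_mat"

text \<open>The row index \<open>l = (i - 1) m + j\<close> (sample \<open>j\<close> of device \<open>i\<close>) is represented by the
  pair \<open>(i, j) :: 'n \<times> 'm\<close>, so that \<open>CARD('n \<times> 'm) = n m = M\<close> and the Kronecker product of
  two square matrices is indexed by pairs.\<close>

definition kron :: "real^'n^'n \<Rightarrow> real^'m^'m \<Rightarrow> real^('n::finite \<times> 'm::finite)^('n \<times> 'm)" where
  "kron A B = (\<chi> p q. A $ fst p $ fst q * B $ snd p $ snd q)"

text \<open>\<open>block_sum\<close> is the \<open>n \<times> M\<close> matrix that is the Kronecker product of the identity of size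
  \<open>n\<close> with the all-ones row vector of length \<open>m\<close>.\<close>

definition block_sum :: "real^('n::finite \<times> 'm::finite)^'n" where
  "block_sum = (\<chi> i p. if fst p = i then 1 else 0)"

definition stack :: "'a \<Rightarrow> 'a^'n" where
  "stack x = (\<chi> i. x)"

definition row_mean :: "real^'d^'n \<Rightarrow> real^'d" where
  "row_mean A = vec (1 / real CARD('n)) v* A"

definition device_fun :: "('n \<Rightarrow> 'm::finite \<Rightarrow> 'a \<Rightarrow> real) \<Rightarrow> 'n \<Rightarrow> 'a \<Rightarrow> real" where
  "device_fun f i x = (1 / real CARD('m)) * (\<Sum>j\<in>UNIV. f i j x)"

definition global_fun :: "('n::finite \<Rightarrow> 'm::finite \<Rightarrow> 'a \<Rightarrow> real) \<Rightarrow> 'a \<Rightarrow> real" where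
  "global_fun f x = (1 / real CARD('n)) * (\<Sum>i\<in>UNIV. device_fun f i x)"

definition grad_stack ::
  "('n::finite \<Rightarrow> 'm::finite \<Rightarrow> real^'d \<Rightarrow> real) \<Rightarrow> real^'d^('n \<times> 'm) \<Rightarrow> real^'d^('n \<times> 'm)" where
  "grad_stack f X = (\<chi> p. gradient (f (fst p) (snd p)) (X $ p))"

text \<open>In the following definitions \<open>S i\<close> is the set of samples that device \<open>i\<close> selects at
  iteration \<open>k\<close>, \<open>S'\<close> is the selection at iteration \<open>k + 1\<close>, and \<open>b\<close> is the common
  number of samples selected by each device at iteration \<open>k\<close>.\<close>

definition sel_mat :: "('n \<Rightarrow> 'm set) \<Rightarrow> real^('n::finite \<times> 'm::finite)^('n \<times> 'm)" where
  "sel_mat S = (\<chi> p q. if p = q \<and> snd p \<in> S (fst p) then 1 else 0)"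

definition spp_Gamma ::
  "real^'n^'n \<Rightarrow> nat \<Rightarrow> ('n \<Rightarrow> 'm set) \<Rightarrow> ('n \<Rightarrow> 'm set) \<Rightarrow> real^('n::finite \<times> 'm::finite)^('n \<times> 'm)" where
  "spp_Gamma W b S S' = sel_mat S' ** kron W ones_mat ** ((1 / real b) *\<^sub>R sel_mat S)"

definition spp_R ::
  "real^'n^'n \<Rightarrow> nat \<Rightarrow> ('n \<Rightarrow> 'm set) \<Rightarrow> ('n \<Rightarrow> 'm set) \<Rightarrow> real^('n::finite \<times> 'm::finite)^('n \<times> 'm)" where
  "spp_R W b S S' = mat 1 - sel_mat S' + spp_Gamma W b S S'"

definition sample_avg :: "nat \<Rightarrow> ('n \<Rightarrow> 'm set) \<Rightarrow> real^'d^('n::finite \<times> 'm::finite) \<Rightarrow> real^'d^'n" where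
  "sample_avg b S X = (block_sum ** ((1 / real b) *\<^sub>R sel_mat S)) ** X"

text \<open>Since \<open>0 - 1 = 0\<close> on \<open>nat\<close>, the argument \<open>X (k - 1)\<close> implements the convention that the
  iterate with index \<open>-1\<close> is \<open>X 0\<close>. The Frobenius norm is \<open>norm\<close> on \<open>real^'d^'n\<close>.\<close>

definition lyapunov ::
  "real \<Rightarrow> real \<Rightarrow> real \<Rightarrow> real \<Rightarrow> ('n::finite \<Rightarrow> 'm::finite \<Rightarrow> real^'d \<Rightarrow> real) \<Rightarrow> real^'d
   \<Rightarrow> (nat \<Rightarrow> real^'d^('n \<times> 'm)) \<Rightarrow> (nat \<Rightarrow> real^'d^('n \<times> 'm))
   \<Rightarrow> (nat \<Rightarrow> nat) \<Rightarrow> (nat \<Rightarrow> 'n \<Rightarrow> 'm set) \<Rightarrow> nat \<Rightarrow> real" where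
  "lyapunov c0 c1 c3 c4 f xs X Y b S k =
     (let Xh = sample_avg (b k) (S k) (X k);
          Yh = sample_avg (b k) (S k) (Y k)
      in c0 * (norm (row_mean Xh - xs))\<^sup>2
       + c1 * (norm (Xh - stack (row_mean Xh)))\<^sup>2
       + c3 * (norm (grad_stack f (X (k - 1)) - grad_stack f (stack xs)))\<^sup>2
       + c4 * (norm (Yh - stack (row_mean Yh)))\<^sup>2)"

end

theory Submission
  imports Defs
begin

text \<open>Why the bound holds. When \<open>C\<close> is the Kronecker product of \<open>W\<close> and \<open>J\<close>, the
sampled averages obey a plain decentralized descent recursion: the device averages
\<open>x\<close> of the selected rows satisfy \<open>x' = W (x - \<alpha> y)\<close>, whatever the next batch is.
The direction is \<open>y = v + h\<close>. Here \<open>v\<close> is the mixed device mean of the previous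
tracker, and \<open>h\<close> averages, over the selected samples, the gradients at \<open>x\<close> minus the gradients
at the last point where each sample was evaluated. If \<open>Z\<close> collects these points, the mean of
\<open>v\<close> over the devices always equals the mean of the stored gradients at \<open>Z\<close>. Hence the mean
of \<open>y\<close> is a SAGA-type estimator: its expectation over the batch is the average of the device
gradients at \<open>x\<close>, and its variance is controlled by the distance of the gradients at \<open>x\<close>
and at \<open>Z\<close> from those at the minimiser.

The triple \<open>(x, Z, v)\<close> is therefore a Markov chain driven by the independent draws of mixing
matrix, batch size and batch. Along this chain the potential

  squared distance of the mean of \<open>x\<close> to the minimiser
  + \<open>c1\<close> * consensus error of \<open>x\<close> + \<open>c3\<close> * gradient error of \<open>Z\<close>
  + \<open>c4\<close> * consensus error of \<open>v\<close>

decreases in expectation by at least \<open>2 \<alpha> (1 - 66 \<alpha> L / (1 - \<rho>)\<^sup>2)\<close> times the expected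
optimality gap (\<open>potential_drift\<close>). Its ingredients are:
 \<^item> descent of the mean for a convex smooth objective (\<open>mean_distance_drift\<close>), which costs
   the consensus error of \<open>x\<close> and the variance of the estimator;
 \<^item> contraction of both consensus errors by mixing (\<open>consensus_drift\<close>), with the factor
   \<open>\<rho>\<close> turned into \<open>(1 + \<rho>) / 2\<close> by Young's inequality;
 \<^item> replacement of stored gradients (\<open>refresh_drift\<close>): each entry of \<open>Z\<close> is renewed with
   mean probability \<open>q\<close>, so a fraction \<open>q\<close> of the gradient error of \<open>Z\<close> is exchanged for
   the gradient error at \<open>x\<close>;
 \<^item> the gradient error at \<open>x\<close> is at most of the order of the consensus error plus the optimality
   gap (\<open>grad_error_spread_le\<close>), by expected smoothness.

Tracking \<open>v\<close> instead of \<open>y\<close> makes all error terms of one iteration refer to the same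
state, so no quantity of the next iterate has to be bounded. The weights are half of the Lyapunov
coefficient for \<open>x\<close> and a quarter of the one for \<open>y\<close>. This leaves the room that the very
first iteration requires: there \<open>y\<close> is a raw mini-batch gradient without correction term.
The variance of its mean is paid for by its consensus error, because the devices sample
independently and because \<open>\<rho> > 0\<close> forces at least two devices (\<open>first_step_drift\<close>).
The first iteration thus leads from the expected Lyapunov function at the start to the potential
with the same decrease, and telescoping (\<open>sum_expected_gap_le\<close>) gives the rate.

All draws take finitely many values, so every expectation is a finite sum, and
\<open>expectation_fresh\<close> replaces the current draw by its average while the past is kept fixed.\<close>

section \<open>Gradients\<close>

lemma gradient_eqI:
  assumes "GDERIV f x :> D"
  shows "gradient f x = D"
  unfolding gradient_def
proof (rule the_equality)
  fix E assume "GDERIV f x :> E"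
  then have "(\<lambda>h. h \<bullet> E) = (\<lambda>h. h \<bullet> D)"
    using assms unfolding gderiv_def by (rule has_derivative_unique)
  then show "E = D" by (metis inner_commute vector_eq_ldot)
qed (fact assms)

lemma GDERIV_gradient:
  fixes f :: "'a::euclidean_space \<Rightarrow> real"
  assumes "f differentiable (at x)"
  shows "GDERIV f x :> gradient f x"
proof -
  obtain f' where f': "(f has_derivative f') (at x)"
    using assms unfolding differentiable_def by blast
  then have "linear f'" using has_derivative_linear by blast
  then have "f' = (\<lambda>h. h \<bullet> adjoint f' 1)"
    by (auto simp: fun_eq_iff adjoint_works)
  then have "GDERIV f x :> adjoint f' 1"
    using f' unfolding gderiv_def by metis
  then show ?thesis using gradient_eqI by metis
qed

lemma GDERIV_sum:
  assumes "\<And>i. i \<in> I \<Longrightarrow> GDERIV (f i) x :> D i"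
  shows "GDERIV (\<lambda>x. \<Sum>i\<in>I. f i x) x :> (\<Sum>i\<in>I. D i)"
  using has_derivative_sum[of I "\<lambda>i. f i" "\<lambda>i h. h \<bullet> D i" "at x"] assms
  by (simp add: gderiv_def inner_sum_right)

lemma GDERIV_cmult:
  assumes "GDERIV f x :> D"
  shows "GDERIV (\<lambda>x. c * f x) x :> c *\<^sub>R D"
  using has_derivative_mult_right[of f "\<lambda>h. h \<bullet> D" "at x" c] assms
  by (simp add: gderiv_def)

lemma gradient_zero_at_minimum:
  fixes f :: "'a::euclidean_space \<Rightarrow> real"
  assumes "GDERIV f x :> D" and "\<And>y. f x \<le> f y"
  shows "D = 0"
proof -
  have "(\<lambda>h. h \<bullet> D) = (\<lambda>v. 0)"
    using assms by (intro differential_zero_maxmin[of x UNIV f]) (auto simp: gderiv_def)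
  then show ?thesis by (metis inner_eq_zero_iff)
qed

section \<open>Rows, means and the consensus error\<close>

lemma matrix_mult_row:
  fixes A :: "real^'k^'i" and X :: "real^'d^'k"
  shows "(A ** X) $ i = (\<Sum>k\<in>UNIV. A $ i $ k *\<^sub>R X $ k)"
  by (simp add: vec_eq_iff matrix_matrix_mult_def)

lemma row_mean_eq: "row_mean (A :: real^'d^'n) = (\<Sum>i\<in>UNIV. A $ i) /\<^sub>R real CARD('n)"
  by (simp add: vec_eq_iff row_mean_def vector_matrix_mult_def sum_distrib_left[symmetric] divide_inverse mult.commute)

lemma linear_row_mean: "linear row_mean"
  by (rule linearI) (simp_all add: row_mean_eq sum.distrib scaleR_right_distrib scaleR_sum_right mult.commute)

lemmas row_mean_add = linear_add[OF linear_row_mean]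
  and row_mean_diff = linear_diff[OF linear_row_mean]
  and row_mean_scaleR = linear_cmul[OF linear_row_mean]

lemma stack_nth [simp]: "stack x $ i = x"
  by (simp add: stack_def)

lemma row_mean_stack [simp]: "row_mean (stack x :: real^'d^'n) = x"
  by (simp add: row_mean_eq sum_constant_scaleR del: sum_constant)

lemma norm_rows_sq: "(norm (A :: 'a::real_inner^'n))\<^sup>2 = (\<Sum>i\<in>UNIV. (norm (A $ i))\<^sup>2)"
  by (simp add: norm_vec_def L2_set_def sum_nonneg)

lemma norm_sum_sq_le: "(norm (\<Sum>i\<in>I. a i))\<^sup>2 \<le> real (card I) * (\<Sum>i\<in>I. (norm (a i))\<^sup>2)"
proof -
  have "(norm (\<Sum>i\<in>I. a i))\<^sup>2 \<le> (\<Sum>i\<in>I. norm (a i))\<^sup>2"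
    by (intro power_mono norm_sum norm_ge_zero)
  also have "\<dots> \<le> real (card I) * (\<Sum>i\<in>I. (norm (a i))\<^sup>2)"
    using sum_squared_le_sum_of_squares[of "\<lambda>i. norm (a i)" I] by (simp add: mult.commute)
  finally show ?thesis .
qed

lemma norm_row_mean_sq_le: "real CARD('n) * (norm (row_mean (A :: real^'d^'n)))\<^sup>2 \<le> (norm A)\<^sup>2"
proof -
  have "(norm (row_mean A))\<^sup>2 = (norm (\<Sum>i\<in>UNIV. A $ i))\<^sup>2 / (real CARD('n))\<^sup>2"
    by (simp add: row_mean_eq power_mult_distrib power_inverse divide_inverse mult.commute)
  also have "\<dots> \<le> (real CARD('n) * (norm A)\<^sup>2) / (real CARD('n))\<^sup>2"
    using norm_sum_sq_le[of "\<lambda>i. A $ i" UNIV] by (intro divide_right_mono) (auto simp: norm_rows_sq)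
  finally show ?thesis by (simp add: power2_eq_square field_simps)
qed

definition center :: "real^'d^'n \<Rightarrow> real^'d^'n" where
  "center A = A - stack (row_mean A)"

lemma linear_center: "linear center"
  by (rule linearI) (simp_all add: vec_eq_iff center_def row_mean_add row_mean_scaleR algebra_simps)

lemmas center_add = linear_add[OF linear_center]
  and center_diff = linear_diff[OF linear_center]
  and center_scaleR = linear_cmul[OF linear_center]

lemma row_mean_center [simp]: "row_mean (center A) = 0"
  by (simp add: center_def row_mean_diff)

lemma norm_center_sq: "(norm (center (A :: real^'d^'n)))\<^sup>2 = (norm A)\<^sup>2 - real CARD('n) * (norm (row_mean A))\<^sup>2"
proof -
  have "A \<bullet> stack (row_mean A) = (\<Sum>i\<in>UNIV. A $ i) \<bullet> row_mean A"
    by (subst inner_vec_def) (simp add: inner_sum_left)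
  also have "(\<Sum>i\<in>UNIV. A $ i) = real CARD('n) *\<^sub>R row_mean A"
    by (simp add: row_mean_eq)
  finally have "A \<bullet> stack (row_mean A) = real CARD('n) * (norm (row_mean A))\<^sup>2"
    by (simp add: power2_norm_eq_inner)
  moreover have "(norm (stack (row_mean A) :: real^'d^'n))\<^sup>2 = real CARD('n) * (norm (row_mean A))\<^sup>2"
    by (simp add: norm_rows_sq)
  ultimately show ?thesis
    by (simp add: center_def power2_norm_eq_inner inner_diff_left inner_diff_right inner_commute)
qed

lemma norm_center_rows: "(norm (center A))\<^sup>2 = (\<Sum>i\<in>UNIV. (norm (A $ i - row_mean A))\<^sup>2)"
  by (subst norm_rows_sq) (simp add: center_def)

lemma norm_center_sq_le: "(norm (center A))\<^sup>2 \<le> (norm A)\<^sup>2"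
  by (simp add: norm_center_sq)

text \<open>Young's inequality, from the square of \<open>e a - b\<close>.\<close>

lemma norm_add_sq_le:
  fixes a b :: "'a::real_inner"
  assumes "0 < e"
  shows "(norm (a + b))\<^sup>2 \<le> (1 + e) * (norm a)\<^sup>2 + (1 + 1 / e) * (norm b)\<^sup>2"
proof -
  have "0 \<le> (norm (e *\<^sub>R a - b))\<^sup>2 / e" using assms by simp
  also have "\<dots> = e * (norm a)\<^sup>2 - 2 * (a \<bullet> b) + (norm b)\<^sup>2 / e"
    unfolding power2_norm_eq_inner using assms
    by (simp add: inner_diff_left inner_diff_right inner_commute field_simps)
  finally show ?thesis unfolding power2_norm_eq_inner using assms
    by (simp add: inner_add_left inner_add_right inner_commute field_simps)
qed

lemma norm_add_sq_le_2:
  fixes a b :: "'a::real_inner"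
  shows "(norm (a + b))\<^sup>2 \<le> 2 * (norm a)\<^sup>2 + 2 * (norm b)\<^sup>2"
  using norm_add_sq_le[of 1 a b] by simp

lemma norm_diff_sq_le_2:
  fixes a b :: "'a::real_inner"
  shows "(norm (a - b))\<^sup>2 \<le> 2 * (norm a)\<^sup>2 + 2 * (norm b)\<^sup>2"
  using norm_add_sq_le_2[of a "- b"] by simp

lemma doubly_stochasticD:
  assumes "doubly_stochastic w"
  shows "(\<Sum>j\<in>UNIV. w $ i $ j) = 1" "(\<Sum>i\<in>UNIV. w $ i $ j) = 1"
  using assms by (auto simp: doubly_stochastic_def)

lemma row_mean_doubly_stochastic_mult:
  assumes "doubly_stochastic w"
  shows "row_mean (w ** A) = row_mean A"
proof -
  have "(\<Sum>i\<in>UNIV. (w ** A) $ i) = (\<Sum>k\<in>UNIV. (\<Sum>i\<in>UNIV. w $ i $ k) *\<^sub>R A $ k)"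
    unfolding matrix_mult_row scaleR_sum_left by (rule sum.swap)
  then show ?thesis using assms by (simp add: row_mean_eq doubly_stochasticD)
qed

lemma avg_mat_mult: "avg_mat ** A = stack (row_mean A)"
  by (simp add: vec_eq_iff matrix_mult_row avg_mat_def ones_mat_def row_mean_eq
      sum_distrib_left divide_inverse mult.commute)

lemma norm_matrix_mult_sq_le:
  fixes A :: "real^'k^'i" and X :: "real^'d^'k"
  shows "(norm (A ** X))\<^sup>2 \<le> (spectral_norm A)\<^sup>2 * (norm X)\<^sup>2"
proof -
  have col: "(norm Z)\<^sup>2 = (\<Sum>c\<in>UNIV. (norm (column c Z))\<^sup>2)" for Z :: "real^'d^'b"
    unfolding norm_rows_sq by (subst sum.swap) (simp add: column_def)
  have "(norm (A ** X))\<^sup>2 = (\<Sum>c\<in>UNIV. (norm (A *v column c X))\<^sup>2)"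
    unfolding col by (simp add: column_def matrix_matrix_mult_def matrix_vector_mult_def)
  also have "\<dots> \<le> (\<Sum>c\<in>UNIV. (spectral_norm A)\<^sup>2 * (norm (column c X))\<^sup>2)"
    unfolding spectral_norm_def power_mult_distrib[symmetric]
    by (intro sum_mono power_mono onorm) auto
  finally show ?thesis by (simp add: col sum_distrib_left)
qed

text \<open>A doubly stochastic matrix commutes with averaging, so centering after mixing is the same as
  applying \<open>w - J\<close> to the centered rows. This is where the spectral gap enters.\<close>

lemma norm_center_mult_sq_le:
  assumes "doubly_stochastic w"
  shows "(norm (center (w ** A)))\<^sup>2 \<le> (spectral_norm (w - avg_mat))\<^sup>2 * (norm (center A))\<^sup>2"
proof -
  have "w ** stack (row_mean A) = stack (row_mean A)"
    using assms by (simp add: vec_eq_iff matrix_mult_row scaleR_sum_left[symmetric] doubly_stochasticD)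
  moreover have "(w - avg_mat) ** center A = w ** center A - avg_mat ** center A"
    by (simp add: vec_eq_iff matrix_matrix_mult_def algebra_simps sum_subtractf)
  moreover have "w ** center A = w ** A - w ** stack (row_mean A)"
    unfolding center_def by (simp add: vec_eq_iff matrix_matrix_mult_def algebra_simps sum_subtractf)
  moreover have "avg_mat ** center A = 0" by (simp add: avg_mat_mult vec_eq_iff)
  ultimately have "center (w ** A) = (w - avg_mat) ** center A"
    by (simp add: center_def[of "w ** A"] row_mean_doubly_stochastic_mult[OF assms])
  then show ?thesis using norm_matrix_mult_sq_le by metis
qed

section \<open>Uniform mini-batches\<close>

definition batches :: "nat \<Rightarrow> ('n::finite \<Rightarrow> 'm::finite set) set" where
  "batches s = {A. \<forall>i. card (A i) = s}"

definition batch_mean :: "nat \<Rightarrow> (('n::finite \<Rightarrow> 'm::finite set) \<Rightarrow> 'a::real_vector) \<Rightarrow> 'a" where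
  "batch_mean s F = (\<Sum>A\<in>batches s. F A) /\<^sub>R real (card (batches s :: ('n \<Rightarrow> 'm set) set))"

lemma card_subsets_of_size: "card {B :: 'm::finite set. card B = s} = CARD('m) choose s"
  using n_subsets[of "UNIV :: 'm set" s] by simp

lemma card_batches:
  "card (batches s :: ('n::finite \<Rightarrow> 'm::finite set) set) = (CARD('m) choose s) ^ CARD('n)"
proof -
  have "(batches s :: ('n \<Rightarrow> 'm set) set) = PiE UNIV (\<lambda>_. {B. card B = s})"
    by (auto simp: batches_def)
  then show ?thesis by (simp add: card_PiE card_subsets_of_size)
qed

lemma card_batches_nonzero:
  assumes "s \<le> CARD('m)"
  shows "real (card (batches s :: ('n::finite \<Rightarrow> 'm::finite set) set)) \<noteq> 0"
  using assms by (simp add: card_batches)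

lemma batch_mean_linear:
  assumes "linear g"
  shows "batch_mean s (\<lambda>A. g (F A)) = g (batch_mean s F)"
  by (simp add: batch_mean_def linear_cmul[OF assms] linear_sum[OF assms])

lemma batch_mean_add: "batch_mean s (\<lambda>A. F A + G A) = batch_mean s F + batch_mean s G"
  by (simp add: batch_mean_def sum.distrib scaleR_right_distrib)

lemma batch_mean_diff: "batch_mean s (\<lambda>A. F A - G A) = batch_mean s F - batch_mean s G"
  by (simp add: batch_mean_def sum_subtractf scaleR_right_diff_distrib)

lemma batch_mean_scaleR: "batch_mean s (\<lambda>A. c *\<^sub>R F A) = c *\<^sub>R batch_mean s F"
  by (simp add: batch_mean_def scaleR_sum_right mult.commute)

lemma batch_mean_cmult: "batch_mean s (\<lambda>A. c * F A) = c * (batch_mean s F :: real)"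
  using batch_mean_scaleR[of s c F] by simp

lemma batch_mean_sum: "batch_mean s (\<lambda>A. \<Sum>i\<in>I. F i A) = (\<Sum>i\<in>I. batch_mean s (F i))"
  unfolding batch_mean_def scaleR_sum_right by (rule sum.swap)

lemma batch_mean_const:
  fixes c :: "'a::real_vector"
  assumes "s \<le> CARD('m)"
  shows "batch_mean s (\<lambda>A :: 'n::finite \<Rightarrow> 'm::finite set. c) = c"
  using card_batches_nonzero[OF assms, where 'n='n]
  by (simp add: batch_mean_def sum_constant_scaleR del: sum_constant)

lemma batch_mean_mono:
  fixes F G :: "('n::finite \<Rightarrow> 'm::finite set) \<Rightarrow> real"
  assumes "\<And>A. A \<in> batches s \<Longrightarrow> F A \<le> G A"
  shows "batch_mean s F \<le> batch_mean s G"
  by (simp add: batch_mean_def assms mult_left_mono sum_mono)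

lemma batch_mean_nonneg:
  fixes F :: "('n::finite \<Rightarrow> 'm::finite set) \<Rightarrow> real"
  assumes "\<And>A. 0 \<le> F A"
  shows "0 \<le> batch_mean s F"
  by (simp add: batch_mean_def assms sum_nonneg)

lemma batch_mean_cong:
  assumes "\<And>A. A \<in> batches s \<Longrightarrow> F A = G A"
  shows "batch_mean s F = batch_mean s G"
  by (simp add: batch_mean_def assms)

text \<open>Uniform batches of distinct devices are independent: redrawing the batch of one device changes
  nothing on average. The reason is that exchanging \<open>A i\<close> with a fresh \<open>B\<close> is an involution
  on pairs. All facts about \<open>batch_mean\<close> that involve individual devices are derived from this.\<close>

lemma sum_batches_resample:
  fixes F :: "('n::finite \<Rightarrow> 'm::finite set) \<Rightarrow> 'a::real_vector"
  shows "(\<Sum>A\<in>batches s. \<Sum>B\<in>{B. card B = s}. F (A(i := B)))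
    = real (CARD('m) choose s) *\<^sub>R (\<Sum>A\<in>batches s. F A)"
proof -
  have "(\<Sum>A\<in>batches s. \<Sum>B\<in>{B. card B = s}. F (A(i := B)))
      = (\<Sum>(A, B)\<in>batches s \<times> {B. card B = s}. F (A(i := B)))"
    by (rule sum.cartesian_product)
  also have "\<dots> = (\<Sum>(A, B)\<in>batches s \<times> {B :: 'm set. card B = s}. F A)"
    by (rule sum.reindex_bij_witness[where i = "\<lambda>(A, B). (A(i := B), A i)" and j = "\<lambda>(A, B). (A(i := B), A i)"])
      (auto simp: batches_def)
  also have "\<dots> = real (CARD('m) choose s) *\<^sub>R (\<Sum>A\<in>batches s. F A)"
    by (simp add: sum.cartesian_product[symmetric] scaleR_sum_right sum_constant_scaleR
        card_subsets_of_size del: sum_constant)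
  finally show ?thesis .
qed

lemma sum_subsets_of_size:
  fixes a :: "'m::finite \<Rightarrow> 'a::real_vector"
  assumes "1 \<le> s"
  shows "(\<Sum>B\<in>{B. card B = s}. \<Sum>j\<in>B. a j)
    = (real (CARD('m) choose s) * (real s / real CARD('m))) *\<^sub>R (\<Sum>j\<in>UNIV. a j)"
proof -
  have count: "real (card {B. card B = s \<and> j \<in> B}) = real (CARD('m) choose s) * (real s / real CARD('m))" for j :: 'm
  proof -
    have "bij_betw (insert j) {B. B \<subseteq> UNIV - {j} \<and> card B = s - 1} {B. card B = s \<and> j \<in> B}"
      using assms
      by (intro bij_betwI[where g = "\<lambda>B. B - {j}"]) (auto simp: insert_absorb card_insert_if)
    then have "card {B. card B = s \<and> j \<in> B} = (CARD('m) - 1) choose (s - 1)"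
      using n_subsets[of "UNIV - {j}" "s - 1"] by (simp add: bij_betw_same_card[symmetric])
    moreover have "s * (CARD('m) choose s) = CARD('m) * ((CARD('m) - 1) choose (s - 1))"
      using assms by (intro times_binomial_minus1_eq) simp
    ultimately show ?thesis
      by (simp add: field_simps flip: of_nat_mult)
  qed
  have "(\<Sum>B\<in>{B. card B = s}. \<Sum>j\<in>B. a j) = (\<Sum>B\<in>{B. card B = s}. \<Sum>j\<in>UNIV. if j \<in> B then a j else 0)"
    by (simp add: sum.If_cases)
  also have "\<dots> = (\<Sum>j\<in>UNIV. \<Sum>B\<in>{B. card B = s}. if j \<in> B then a j else 0)"
    by (rule sum.swap)
  also have "\<dots> = (\<Sum>j\<in>UNIV. real (card {B. card B = s \<and> j \<in> B}) *\<^sub>R a j)"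
    by (intro sum.cong refl) (simp add: sum.If_cases sum_constant_scaleR Int_def del: sum_constant)
  finally show ?thesis by (simp add: count scaleR_sum_right)
qed

lemma batch_mean_sum_selected:
  fixes a :: "'m::finite \<Rightarrow> 'a::real_vector" and i :: "'n::finite"
  assumes "1 \<le> s" "s \<le> CARD('m)"
  shows "batch_mean s (\<lambda>A :: 'n \<Rightarrow> 'm set. \<Sum>j\<in>A i. a j) = (real s / real CARD('m)) *\<^sub>R (\<Sum>j\<in>UNIV. a j)"
proof -
  let ?N = "real (CARD('m) choose s)"
  have N: "?N \<noteq> 0" using assms by simp
  have "?N *\<^sub>R (\<Sum>A\<in>batches s. \<Sum>j\<in>(A :: 'n \<Rightarrow> 'm set) i. a j)
      = real (card (batches s :: ('n \<Rightarrow> 'm set) set)) *\<^sub>R (\<Sum>B\<in>{B. card B = s}. \<Sum>j\<in>B. a j)"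
    unfolding sum_batches_resample[where s=s and i=i and F="\<lambda>A. \<Sum>j\<in>A i. a j", symmetric]
    by (simp add: sum_constant_scaleR del: sum_constant)
  also have "\<dots> = ?N *\<^sub>R real (card (batches s :: ('n \<Rightarrow> 'm set) set)) *\<^sub>R (real s / real CARD('m)) *\<^sub>R (\<Sum>j\<in>UNIV. a j)"
    by (simp add: sum_subsets_of_size[OF assms(1)] mult.commute)
  finally have "(\<Sum>A\<in>batches s. \<Sum>j\<in>(A :: 'n \<Rightarrow> 'm set) i. a j)
      = real (card (batches s :: ('n \<Rightarrow> 'm set) set)) *\<^sub>R (real s / real CARD('m)) *\<^sub>R (\<Sum>j\<in>UNIV. a j)"
    using N by (simp only: scaleR_cancel_left) simp
  then show ?thesis
    using card_batches_nonzero[OF assms(2), where 'n='n] by (simp add: batch_mean_def)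
qed

text \<open>Devices are uncorrelated: redraw the batch of device \<open>i\<close> while that of \<open>i'\<close> stays fixed.\<close>

lemma batch_mean_inner_distinct_devices:
  fixes F G :: "'m::finite set \<Rightarrow> 'a::real_inner" and i i' :: "'n::finite"
  assumes "s \<le> CARD('m)" "i \<noteq> i'" and zero: "batch_mean s (\<lambda>A :: 'n \<Rightarrow> 'm set. F (A i)) = 0"
  shows "batch_mean s (\<lambda>A :: 'n \<Rightarrow> 'm set. F (A i) \<bullet> G (A i')) = 0"
proof -
  have N: "real (CARD('m) choose s) \<noteq> 0" using assms by simp
  have pos: "real (card (batches s :: ('n \<Rightarrow> 'm set) set)) \<noteq> 0"
    using card_batches_nonzero[OF assms(1), where 'n='n] by simp
  have "(\<Sum>A\<in>(batches s :: ('n \<Rightarrow> 'm set) set). F (A i)) = 0"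
    using zero pos by (simp add: batch_mean_def)
  then have "real (card (batches s :: ('n \<Rightarrow> 'm set) set)) *\<^sub>R (\<Sum>B\<in>{B. card B = s}. F B) = 0"
    using sum_batches_resample[where s=s and i=i and F="\<lambda>A. F (A i)"] by (simp add: sum_constant_scaleR del: sum_constant)
  then have F0: "(\<Sum>B\<in>{B. card B = s}. F B) = 0" using pos by simp
  have "real (CARD('m) choose s) *\<^sub>R (\<Sum>A\<in>(batches s :: ('n \<Rightarrow> 'm set) set). F (A i) \<bullet> G (A i')) = 0"
    unfolding sum_batches_resample[where s=s and i=i, symmetric]
    using assms(2) F0 by (simp add: inner_sum_left[symmetric])
  then show ?thesis using N by (simp add: batch_mean_def)
qed

lemma batch_mean_norm_sq_add:
  fixes E :: "('n::finite \<Rightarrow> 'm::finite set) \<Rightarrow> 'a::real_inner"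
  assumes "s \<le> CARD('m)" "batch_mean s E = 0"
  shows "batch_mean s (\<lambda>A. (norm (c + E A))\<^sup>2) = (norm c)\<^sup>2 + batch_mean s (\<lambda>A. (norm (E A))\<^sup>2)"
proof -
  have "batch_mean s (\<lambda>A. (norm (c + E A))\<^sup>2)
      = batch_mean s (\<lambda>A. (norm c)\<^sup>2 + (2 * (c \<bullet> E A) + (norm (E A))\<^sup>2))"
    by (intro batch_mean_cong)
      (simp add: power2_norm_eq_inner inner_add_left inner_add_right inner_commute)
  moreover have "batch_mean s (\<lambda>A. c \<bullet> E A) = c \<bullet> batch_mean s E"
    by (rule batch_mean_linear) (rule bounded_linear.linear[OF bounded_linear_inner_right])
  ultimately show ?thesis
    using assms by (simp add: batch_mean_add batch_mean_cmult batch_mean_const)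
qed

lemma batch_variance_le:
  fixes E :: "('n::finite \<Rightarrow> 'm::finite set) \<Rightarrow> 'a::real_inner"
  assumes "s \<le> CARD('m)"
  shows "batch_mean s (\<lambda>A. (norm (E A - batch_mean s E))\<^sup>2) \<le> batch_mean s (\<lambda>A. (norm (E A))\<^sup>2)"
  using batch_mean_norm_sq_add[of s "\<lambda>A. E A - batch_mean s E" "batch_mean s E"] assms
  by (simp add: batch_mean_diff batch_mean_const)

section \<open>Averages of the sampled rows\<close>

lemma sum_UNIV_prod: "(\<Sum>p\<in>UNIV. g p) = (\<Sum>i\<in>UNIV. \<Sum>j\<in>UNIV. g (i, j))"
  unfolding UNIV_Times_UNIV[symmetric] sum.cartesian_product by simp

lemma sample_avg_nth:
  fixes Z :: "real^'d^('n::finite \<times> 'm::finite)"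
  shows "sample_avg s A Z $ i = (\<Sum>j\<in>A i. Z $ (i, j)) /\<^sub>R real s"
proof -
  have coeff: "(block_sum ** ((1 / real s) *\<^sub>R sel_mat A)) $ i $ q
      = (if fst q = i \<and> snd q \<in> A i then 1 / real s else 0)" for q :: "'n \<times> 'm"
  proof -
    have "(block_sum ** ((1 / real s) *\<^sub>R sel_mat A)) $ i $ q
        = (\<Sum>p\<in>UNIV. block_sum $ i $ p * ((1 / real s) *\<^sub>R sel_mat A) $ p $ q)"
      by (simp add: matrix_matrix_mult_def)
    also have "\<dots> = (\<Sum>p\<in>UNIV. if p = q then (if fst q = i \<and> snd q \<in> A i then 1 / real s else 0) else 0)"
      by (intro sum.cong refl) (auto simp: block_sum_def sel_mat_def)
    finally show ?thesis by simp
  qed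
  have "sample_avg s A Z $ i = (\<Sum>i'\<in>UNIV. \<Sum>j\<in>UNIV. (if i' = i \<and> j \<in> A i then 1 / real s else 0) *\<^sub>R Z $ (i', j))"
    unfolding sample_avg_def by (subst matrix_mult_row) (simp only: coeff sum_UNIV_prod fst_conv snd_conv)
  also have "\<dots> = (\<Sum>i'\<in>UNIV. if i' = i then (\<Sum>j\<in>UNIV. if j \<in> A i then (1 / real s) *\<^sub>R Z $ (i, j) else 0) else 0)"
    by (intro sum.cong refl) (auto intro!: sum.cong sum.neutral)
  also have "\<dots> = (\<Sum>j\<in>A i. (1 / real s) *\<^sub>R Z $ (i, j))"
    by (simp add: sum.If_cases)
  finally show ?thesis by (simp add: scaleR_sum_right divide_inverse)
qed

lemma linear_sample_avg: "linear (sample_avg s A)"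
  by (rule linearI)
    (simp_all add: vec_eq_iff sample_avg_nth sum.distrib scaleR_right_distrib scaleR_sum_right mult.commute)

definition device_mean :: "real^'d^('n::finite \<times> 'm::finite) \<Rightarrow> real^'d^'n" where
  "device_mean Z = sample_avg CARD('m) (\<lambda>_. UNIV) Z"

lemma device_mean_nth:
  "device_mean (Z :: real^'d^('n::finite \<times> 'm::finite)) $ i = (\<Sum>j\<in>UNIV. Z $ (i, j)) /\<^sub>R real CARD('m)"
  by (simp add: device_mean_def sample_avg_nth)

lemma linear_device_mean: "linear device_mean"
  unfolding device_mean_def[abs_def] by (rule linear_sample_avg)

lemma batch_mean_sample_avg:
  fixes Z :: "real^'d^('n::finite \<times> 'm::finite)"
  assumes "1 \<le> s" "s \<le> CARD('m)"
  shows "batch_mean s (\<lambda>A. sample_avg s A Z) = device_mean Z"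
proof -
  have "batch_mean s (\<lambda>A. sample_avg s A Z) $ i = device_mean Z $ i" for i
  proof -
    have "batch_mean s (\<lambda>A. sample_avg s A Z) $ i = batch_mean s (\<lambda>A. sample_avg s A Z $ i)"
      by (rule batch_mean_linear[symmetric]) (simp add: linear_iff)
    also have "\<dots> = batch_mean s (\<lambda>A. \<Sum>j\<in>A i. Z $ (i, j)) /\<^sub>R real s"
      by (simp add: sample_avg_nth batch_mean_scaleR)
    finally show ?thesis
      using assms by (simp add: batch_mean_sum_selected device_mean_nth divide_inverse)
  qed
  then show ?thesis by (simp add: vec_eq_iff)
qed

text \<open>Jensen's inequality inside each batch; afterwards every sample has weight \<open>1 / m\<close>,
  whatever the batch size.\<close>

lemma batch_mean_norm_sample_avg_sq_le:
  fixes Z :: "real^'d^('n::finite \<times> 'm::finite)"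
  assumes "1 \<le> s" "s \<le> CARD('m)"
  shows "batch_mean s (\<lambda>A. (norm (sample_avg s A Z))\<^sup>2) \<le> (norm Z)\<^sup>2 / real CARD('m)"
proof -
  have "batch_mean s (\<lambda>A. (norm (sample_avg s A Z))\<^sup>2)
      \<le> batch_mean s (\<lambda>A. \<Sum>i\<in>UNIV. (1 / real s) * (\<Sum>j\<in>A i. (norm (Z $ (i, j)))\<^sup>2))"
  proof (rule batch_mean_mono)
    fix A :: "'n \<Rightarrow> 'm set" assume A: "A \<in> batches s"
    have "(norm (sample_avg s A Z $ i))\<^sup>2 \<le> (1 / real s) * (\<Sum>j\<in>A i. (norm (Z $ (i, j)))\<^sup>2)" for i
    proof -
      have "(norm (sample_avg s A Z $ i))\<^sup>2 = (norm (\<Sum>j\<in>A i. Z $ (i, j)))\<^sup>2 / (real s)\<^sup>2"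
        by (simp add: sample_avg_nth power_mult_distrib power_inverse divide_inverse mult.commute)
      also have "\<dots> \<le> (real s * (\<Sum>j\<in>A i. (norm (Z $ (i, j)))\<^sup>2)) / (real s)\<^sup>2"
        using norm_sum_sq_le[of "\<lambda>j. Z $ (i, j)" "A i"] A
        by (intro divide_right_mono) (auto simp: batches_def)
      finally show ?thesis using assms by (simp add: power2_eq_square field_simps)
    qed
    then show "(norm (sample_avg s A Z))\<^sup>2 \<le> (\<Sum>i\<in>UNIV. (1 / real s) * (\<Sum>j\<in>A i. (norm (Z $ (i, j)))\<^sup>2))"
      unfolding norm_rows_sq[of "sample_avg s A Z"] by (rule sum_mono)
  qed
  also have "\<dots> = (norm Z)\<^sup>2 / real CARD('m)"
    using assms unfolding norm_rows_sq[of Z] sum_UNIV_prod batch_mean_sum batch_mean_cmult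
    by (simp add: batch_mean_sum_selected[OF assms] sum_divide_distrib)
  finally show ?thesis .
qed

lemma batch_mean_sum_replaced:
  fixes a c :: "'n::finite \<times> 'm::finite \<Rightarrow> real"
  assumes "1 \<le> s" "s \<le> CARD('m)"
  shows "batch_mean s (\<lambda>A. \<Sum>p\<in>UNIV. if snd p \<in> A (fst p) then a p else c p)
    = (real s / real CARD('m)) * (\<Sum>p\<in>UNIV. a p) + (1 - real s / real CARD('m)) * (\<Sum>p\<in>UNIV. c p)"
proof -
  have "(\<Sum>p\<in>UNIV. if snd p \<in> A (fst p) then a p else c p)
      = (\<Sum>p\<in>UNIV. c p) + (\<Sum>i\<in>UNIV. \<Sum>j\<in>A i. a (i, j) - c (i, j))" for A :: "'n \<Rightarrow> 'm set"
  proof -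
    have "(\<Sum>p\<in>UNIV. if snd p \<in> A (fst p) then a p else c p)
        = (\<Sum>p\<in>UNIV. c p + (if snd p \<in> A (fst p) then a p - c p else 0))"
      by (intro sum.cong) auto
    then show ?thesis
      by (simp add: sum.distrib sum_UNIV_prod[of "\<lambda>p. if _ p then _ p else 0"] sum.If_cases)
  qed
  then have "batch_mean s (\<lambda>A. \<Sum>p\<in>UNIV. if snd p \<in> A (fst p) then a p else c p)
    = (\<Sum>p\<in>UNIV. c p) + (\<Sum>i\<in>UNIV. (real s / real CARD('m)) *\<^sub>R (\<Sum>j\<in>UNIV. a (i, j) - c (i, j)))"
    by (simp only: batch_mean_add batch_mean_sum batch_mean_const[OF assms(2)] batch_mean_sum_selected[OF assms])
  also have "\<dots> = (\<Sum>p\<in>UNIV. c p) + (real s / real CARD('m)) * ((\<Sum>p\<in>UNIV. a p) - (\<Sum>p\<in>UNIV. c p))"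
    by (simp add: sum_UNIV_prod sum_subtractf sum_distrib_left[symmetric] sum_divide_distrib[symmetric])
  finally show ?thesis by (simp add: algebra_simps)
qed

text \<open>Averaging over \<open>n\<close> independent devices divides the variance by \<open>n\<close>. The factor is
  \<open>1 / n\<^sup>2\<close> here because the Frobenius norm on the right sums over the devices.\<close>

lemma batch_variance_row_mean:
  fixes Z :: "real^'d^('n::finite \<times> 'm::finite)"
  assumes "1 \<le> s" "s \<le> CARD('m)"
  shows "batch_mean s (\<lambda>A. (norm (row_mean (sample_avg s A Z - device_mean Z)))\<^sup>2)
    = batch_mean s (\<lambda>A. (norm (sample_avg s A Z - device_mean Z))\<^sup>2) / (real CARD('n))\<^sup>2"
proof -
  let ?e = "\<lambda>i B. (\<Sum>j\<in>B. Z $ (i, j)) /\<^sub>R real s - device_mean Z $ i"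
  have e: "(sample_avg s A Z - device_mean Z) $ i = ?e i (A i)" for i and A :: "'n \<Rightarrow> 'm set"
    by (simp add: sample_avg_nth)
  have mean0: "batch_mean s (\<lambda>A :: 'n \<Rightarrow> 'm set. ?e i (A i)) = 0" for i
    using assms by (simp add: batch_mean_diff batch_mean_scaleR batch_mean_const batch_mean_sum_selected
        device_mean_nth divide_inverse)
  have cross: "batch_mean s (\<lambda>A :: 'n \<Rightarrow> 'm set. ?e i (A i) \<bullet> ?e i' (A i'))
      = (if i = i' then batch_mean s (\<lambda>A :: 'n \<Rightarrow> 'm set. (norm (?e i (A i)))\<^sup>2) else 0)" for i i'
    using batch_mean_inner_distinct_devices[OF assms(2) _ mean0[of i], of i' "?e i'"]
    by (simp add: power2_norm_eq_inner)
  have "batch_mean s (\<lambda>A :: 'n \<Rightarrow> 'm set. (norm (\<Sum>i\<in>UNIV. ?e i (A i)))\<^sup>2)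
      = (\<Sum>i\<in>UNIV. \<Sum>i'\<in>UNIV. batch_mean s (\<lambda>A :: 'n \<Rightarrow> 'm set. ?e i (A i) \<bullet> ?e i' (A i')))"
    by (simp add: power2_norm_eq_inner inner_sum_left inner_sum_right batch_mean_sum) (rule sum.swap)
  also have "\<dots> = (\<Sum>i\<in>UNIV. batch_mean s (\<lambda>A :: 'n \<Rightarrow> 'm set. (norm (?e i (A i)))\<^sup>2))"
    by (simp add: cross)
  also have "\<dots> = batch_mean s (\<lambda>A. (norm (sample_avg s A Z - device_mean Z))\<^sup>2)"
    by (simp add: norm_rows_sq[of "sample_avg _ _ _ - _"] batch_mean_sum e del: vector_minus_component)
  finally show ?thesis
    by (simp add: row_mean_eq e power_mult_distrib batch_mean_cmult power_inverse divide_inverse mult.commute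
        del: vector_minus_component)
qed

section \<open>The objective\<close>

text \<open>The stack of sample points in which every sample of a device sits at the point of the device.\<close>

definition spread :: "real^'d^'n \<Rightarrow> real^'d^('n::finite \<times> 'm::finite)" where
  "spread x = (\<chi> p. x $ fst p)"

lemma spread_nth [simp]: "spread x $ p = x $ fst p"
  by (simp add: spread_def)

lemma spread_stack [simp]: "spread (stack z) = stack z"
  by (simp add: vec_eq_iff)

lemma grad_stack_nth: "grad_stack f Z $ (i, j) = gradient (f i j) (Z $ (i, j))"
  by (simp add: grad_stack_def)

lemma norm_device_mean_sq_le:
  fixes Z :: "real^'d^('n::finite \<times> 'm::finite)"
  shows "real CARD('m) * (norm (device_mean Z))\<^sup>2 \<le> (norm Z)\<^sup>2"
proof -
  have "real CARD('m) * (norm (device_mean Z $ i))\<^sup>2 \<le> (\<Sum>j\<in>UNIV. (norm (Z $ (i, j)))\<^sup>2)" for i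
    using norm_sum_sq_le[of "\<lambda>j. Z $ (i, j)" UNIV]
    by (simp add: device_mean_nth power_mult_distrib power2_eq_square field_simps)
  then show ?thesis
    by (simp add: norm_rows_sq[of "device_mean Z"] norm_rows_sq[of Z] sum_UNIV_prod sum_distrib_left sum_mono)
qed

locale spp_objective =
  fixes f :: "'n::finite \<Rightarrow> 'm::finite \<Rightarrow> real^'d \<Rightarrow> real"
    and xs :: "real^'d"
    and L :: real
  assumes diff: "\<And>i j x. f i j differentiable (at x)"
    and argmin: "\<And>x. global_fun f xs \<le> global_fun f x"
    and L_pos: "0 < L"
    and smooth: "\<And>i x x'.
      norm (gradient (device_fun f i) x - gradient (device_fun f i) x') \<le> L * norm (x - x')"
    and expected_smooth: "\<And>i x x'.
      (1 / real CARD('m)) * (\<Sum>j\<in>UNIV. (norm (gradient (f i j) x - gradient (f i j) x'))\<^sup>2)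
        \<le> 2 * L * (device_fun f i x - device_fun f i x'
                    - gradient (device_fun f i) x' \<bullet> (x - x'))"
begin

abbreviation (input) bregman :: "'n \<Rightarrow> real^'d \<Rightarrow> real^'d \<Rightarrow> real" where
  "bregman i x y \<equiv> device_fun f i x - device_fun f i y - gradient (device_fun f i) y \<bullet> (x - y)"

abbreviation gap :: "real^'d^'n \<Rightarrow> real" where
  "gap x \<equiv> global_fun f (row_mean x) - global_fun f xs"

abbreviation grad_error :: "real^'d^('n \<times> 'm) \<Rightarrow> real" where
  "grad_error Z \<equiv> (norm (grad_stack f Z - grad_stack f (stack xs)))\<^sup>2"

abbreviation mean_grad :: "real^'d^'n \<Rightarrow> real^'d" where
  "mean_grad x \<equiv> row_mean (device_mean (grad_stack f (spread x)))"

lemma GDERIV_device_fun: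
  "GDERIV (device_fun f i) x :> (1 / real CARD('m)) *\<^sub>R (\<Sum>j\<in>UNIV. gradient (f i j) x)"
  unfolding device_fun_def[abs_def]
  by (intro GDERIV_cmult GDERIV_sum GDERIV_gradient diff)

lemma gradient_device_fun:
  "gradient (device_fun f i) x = (\<Sum>j\<in>UNIV. gradient (f i j) x) /\<^sub>R real CARD('m)"
  using gradient_eqI[OF GDERIV_device_fun] by (simp add: divide_inverse)

lemma device_mean_grad_stack: "device_mean (grad_stack f (spread x)) $ i = gradient (device_fun f i) (x $ i)"
  by (simp add: device_mean_nth gradient_device_fun grad_stack_nth)

lemma sum_gradient_min: "(\<Sum>i\<in>UNIV. gradient (device_fun f i) xs) = 0"
proof -
  have "GDERIV (global_fun f) xs :> (1 / real CARD('n)) *\<^sub>R (\<Sum>i\<in>UNIV. gradient (device_fun f i) xs)"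
    unfolding global_fun_def[abs_def] gradient_eqI[OF GDERIV_device_fun]
    by (intro GDERIV_cmult GDERIV_sum GDERIV_device_fun)
  then have "(1 / real CARD('n)) *\<^sub>R (\<Sum>i\<in>UNIV. gradient (device_fun f i) xs) = 0"
    using argmin by (rule gradient_zero_at_minimum)
  then show ?thesis by simp
qed

lemma mean_grad_min: "mean_grad (stack xs) = 0"
  using sum_gradient_min by (simp add: row_mean_eq device_mean_grad_stack del: spread_stack)

lemma bregman_nonneg: "0 \<le> bregman i x y"
proof -
  have "0 \<le> (1 / real CARD('m)) * (\<Sum>j\<in>UNIV. (norm (gradient (f i j) x - gradient (f i j) y))\<^sup>2)"
    by (simp add: sum_nonneg)
  then have "0 \<le> (2 * L) * bregman i x y"
    using expected_smooth[where i=i and x=x and x'=y] by linarith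
  then show ?thesis using L_pos by (simp add: zero_le_mult_iff)
qed

text \<open>Adding the divergence with exchanged arguments, which is nonnegative, gives an inner product of
  differences, to which smoothness applies directly.\<close>

lemma bregman_le: "bregman i x y \<le> L * (norm (x - y))\<^sup>2"
proof -
  have "bregman i x y \<le> bregman i x y + bregman i y x"
    using bregman_nonneg[of i y x] by linarith
  also have "\<dots> = (gradient (device_fun f i) x - gradient (device_fun f i) y) \<bullet> (x - y)"
    by (simp add: inner_diff_left inner_diff_right)
  also have "\<dots> \<le> norm (gradient (device_fun f i) x - gradient (device_fun f i) y) * norm (x - y)"
    by (rule norm_cauchy_schwarz)
  also have "\<dots> \<le> L * norm (x - y) * norm (x - y)"
    by (intro mult_right_mono smooth norm_ge_zero)
  finally show ?thesis by (simp add: power2_eq_square)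
qed

lemma sum_bregman_min:
  "(\<Sum>i\<in>UNIV. bregman i z xs) = real CARD('n) * (global_fun f z - global_fun f xs)"
proof -
  have "(\<Sum>i\<in>UNIV. gradient (device_fun f i) xs \<bullet> (z - xs)) = 0"
    using sum_gradient_min by (simp add: inner_sum_left[symmetric])
  then show ?thesis
    by (simp add: sum_subtractf global_fun_def right_diff_distrib)
qed

text \<open>Pass through the mean point: expected smoothness bounds the gradient differences by Bregman
  divergences. Those between \<open>x $ i\<close> and the mean give the consensus error. Those between the
  mean and the minimiser sum to the optimality gap, because the gradients at the minimiser cancel.\<close>

lemma grad_error_spread_le:
  "grad_error (spread x) \<le> 4 * L\<^sup>2 * real CARD('m) * (norm (center x))\<^sup>2
    + 4 * L * real (CARD('n) * CARD('m)) * gap x"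
proof -
  let ?g = "\<lambda>i j. gradient (f i j)" and ?m = "real CARD('m)"
  have es: "(\<Sum>j\<in>UNIV. (norm (?g i j y - ?g i j y'))\<^sup>2) \<le> ?m * (2 * L * bregman i y y')" for i y y'
    using expected_smooth[where i=i and x=y and x'=y'] by (simp add: field_simps)
  have "grad_error (spread x) = (\<Sum>i\<in>UNIV. \<Sum>j\<in>UNIV. (norm (?g i j (x $ i) - ?g i j xs))\<^sup>2)"
    by (simp add: norm_rows_sq[of "grad_stack _ _ - _"] sum_UNIV_prod grad_stack_nth)
  also have "\<dots> \<le> (\<Sum>i\<in>UNIV. \<Sum>j\<in>UNIV. 2 * (norm (?g i j (x $ i) - ?g i j (row_mean x)))\<^sup>2
      + 2 * (norm (?g i j (row_mean x) - ?g i j xs))\<^sup>2)"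
    by (intro sum_mono order_trans[OF _ norm_add_sq_le_2]) simp
  also have "\<dots> = (\<Sum>i\<in>UNIV. 2 * (\<Sum>j\<in>UNIV. (norm (?g i j (x $ i) - ?g i j (row_mean x)))\<^sup>2)
      + 2 * (\<Sum>j\<in>UNIV. (norm (?g i j (row_mean x) - ?g i j xs))\<^sup>2))"
    by (simp add: sum.distrib sum_distrib_left)
  also have "\<dots> \<le> (\<Sum>i\<in>UNIV. 2 * (?m * (2 * L * (L * (norm (x $ i - row_mean x))\<^sup>2)))
      + 2 * (?m * (2 * L * bregman i (row_mean x) xs)))"
    using L_pos
    by (intro sum_mono add_mono mult_left_mono order_trans[OF es] bregman_le) auto
  also have "\<dots> = 4 * L\<^sup>2 * ?m * (\<Sum>i\<in>UNIV. (norm (x $ i - row_mean x))\<^sup>2)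
      + 4 * L * ?m * (\<Sum>i\<in>UNIV. bregman i (row_mean x) xs)"
    by (simp only: sum.distrib sum_distrib_left) (simp add: power2_eq_square mult_ac)
  also have "(\<Sum>i\<in>UNIV. (norm (x $ i - row_mean x))\<^sup>2) = (norm (center x))\<^sup>2"
    by (rule norm_center_rows[symmetric])
  finally show ?thesis by (simp only: sum_bregman_min) (simp add: mult_ac)
qed

text \<open>Convexity at \<open>x $ i\<close> towards the minimiser and the upper bound on the divergence towards the
  mean point, added over the devices.\<close>

lemma mean_grad_descent:
  "gap x - L * (norm (center x))\<^sup>2 / real CARD('n) \<le> mean_grad x \<bullet> (row_mean x - xs)"
proof -
  let ?G = "\<lambda>i. gradient (device_fun f i)" and ?n = "real CARD('n)"
  have "?n * gap x - L * (norm (center x))\<^sup>2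
      = (\<Sum>i\<in>UNIV. device_fun f i (row_mean x) - device_fun f i xs - L * (norm (row_mean x - x $ i))\<^sup>2)"
    by (simp add: norm_center_rows sum_subtractf sum_distrib_left global_fun_def
        right_diff_distrib norm_minus_commute)
  also have "\<dots> \<le> (\<Sum>i\<in>UNIV. ?G i (x $ i) \<bullet> (row_mean x - xs))"
  proof (rule sum_mono)
    fix i
    have "row_mean x - xs = (row_mean x - x $ i) - (xs - x $ i)" by simp
    then have "?G i (x $ i) \<bullet> (row_mean x - xs)
        = ?G i (x $ i) \<bullet> (row_mean x - x $ i) - ?G i (x $ i) \<bullet> (xs - x $ i)"
      by (metis inner_diff_right)
    then show "device_fun f i (row_mean x) - device_fun f i xs - L * (norm (row_mean x - x $ i))\<^sup>2
        \<le> ?G i (x $ i) \<bullet> (row_mean x - xs)"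
      using bregman_le[of i "row_mean x" "x $ i"] bregman_nonneg[of i xs "x $ i"] by linarith
  qed
  also have "\<dots> = ?n * (mean_grad x \<bullet> (row_mean x - xs))"
    by (simp add: row_mean_eq[of "device_mean _"] device_mean_grad_stack inner_sum_left)
  finally show ?thesis by (simp add: field_simps)
qed

lemma norm_mean_grad_sq_le: "(norm (mean_grad x))\<^sup>2 \<le> grad_error (spread x) / real (CARD('n) * CARD('m))"
proof -
  let ?E = "grad_stack f (spread x) - grad_stack f (stack xs) :: real^'d^('n \<times> 'm)"
  have "mean_grad x = row_mean (device_mean ?E)"
    using mean_grad_min by (simp add: linear_diff[OF linear_device_mean] row_mean_diff)
  then have "real CARD('n) * (norm (mean_grad x))\<^sup>2 \<le> (norm (device_mean ?E))\<^sup>2"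
    using norm_row_mean_sq_le by metis
  then have "real CARD('m) * (real CARD('n) * (norm (mean_grad x))\<^sup>2) \<le> real CARD('m) * (norm (device_mean ?E))\<^sup>2"
    by (intro mult_left_mono) auto
  also have "\<dots> \<le> (norm ?E)\<^sup>2" by (rule norm_device_mean_sq_le)
  finally show ?thesis by (simp add: field_simps)
qed

lemma gap_nonneg: "0 \<le> gap x"
  using argmin by simp

end

section \<open>The drift of the potential in one iteration\<close>

text \<open>The stored points after a batch \<open>A\<close> has been evaluated at the device points \<open>x\<close>.\<close>

definition refresh :: "('n \<Rightarrow> 'm set) \<Rightarrow> real^'d^'n \<Rightarrow> real^'d^('n::finite \<times> 'm::finite) \<Rightarrow> real^'d^('n \<times> 'm)" where
  "refresh A x Z = (\<chi> p. if snd p \<in> A (fst p) then x $ fst p else Z $ p)"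

type_synonym ('d, 'n, 'm) spp_state = "(real^'d^'n) \<times> (real^'d^('n \<times> 'm)) \<times> (real^'d^'n)"

locale spp_drift = spp_objective f xs L
  for f :: "'n::finite \<Rightarrow> 'm::finite \<Rightarrow> real^'d \<Rightarrow> real" and xs :: "real^'d" and L :: real +
  fixes \<alpha> \<rho> q :: real
  assumes \<alpha>_pos: "0 < \<alpha>" and \<rho>_pos: "0 < \<rho>" and \<rho>_less_1: "\<rho> < 1" and q_pos: "0 < q"
    and \<alpha>_le: "1056 * (\<alpha> * L) \<le> (1 - \<rho>)\<^sup>2"
begin

text \<open>The weights are tuned as follows: \<open>c1\<close> and \<open>c4\<close> make the consensus error of
  \<open>v\<close> break even in one iteration, and \<open>c3 q\<close> covers the gradient error of \<open>Z\<close> that the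
  variance terms create. The Lyapunov function of the statement has twice the weight \<open>c1\<close>,
  the same \<open>c3\<close>, and four times the weight \<open>c4\<close>.\<close>

definition c1 :: real where "c1 = (1 - \<rho>) / (2 * real CARD('n) * \<rho> * (1 + \<rho>))"
definition c3 :: real where "c3 = 20 * \<alpha>\<^sup>2 / (real CARD('n) * real CARD('m) * q * (1 - \<rho>)\<^sup>2)"
definition c4 :: real where "c4 = 2 * \<alpha>\<^sup>2 / (real CARD('n) * (1 - \<rho>))"

text \<open>In a state \<open>(x, Z, v)\<close>, the rows of \<open>x\<close> are the current device points, \<open>Z\<close> holds the points
  at which the samples were last evaluated, and \<open>v\<close> is the part of the descent direction that is
  already determined before the next batch is drawn.\<close>

fun potential :: "('d, 'n, 'm) spp_state \<Rightarrow> real" where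
  "potential (x, Z, v) = (norm (row_mean x - xs))\<^sup>2 + c1 * (norm (center x))\<^sup>2
     + c3 * grad_error Z + c4 * (norm (center v))\<^sup>2"

text \<open>The correction term of variance-reduced sampling: new minus stored gradients on the batch.\<close>

definition increment :: "nat \<Rightarrow> ('n \<Rightarrow> 'm set) \<Rightarrow> real^'d^'n \<Rightarrow> real^'d^('n \<times> 'm) \<Rightarrow> real^'d^'n" where
  "increment s A x Z = sample_avg s A (grad_stack f (spread x) - grad_stack f Z)"

text \<open>The device points move along the direction \<open>v + h\<close> for the sampled correction \<open>h\<close>. The tracker,
  averaged over all samples of a device, only gains the fraction \<open>s / m\<close> of it: the stored
  gradients outside the batch do not change.\<close>

fun step :: "real^'n^'n \<Rightarrow> nat \<Rightarrow> ('n \<Rightarrow> 'm set) \<Rightarrow> ('d, 'n, 'm) spp_state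
    \<Rightarrow> ('d, 'n, 'm) spp_state" where
  "step w s A (x, Z, v) =
     (w ** (x - \<alpha> *\<^sub>R (v + increment s A x Z)), refresh A x Z,
      w ** (v + (real s / real CARD('m)) *\<^sub>R increment s A x Z))"

lemma n_pos: "1 \<le> real CARD('n)" and m_pos: "1 \<le> real CARD('m)"
  by (simp_all add: Suc_le_eq)

lemma c_nonneg: "0 \<le> c1" "0 \<le> c3" "0 \<le> c4"
  using \<alpha>_pos \<rho>_pos \<rho>_less_1 q_pos by (simp_all add: c1_def c3_def c4_def)

text \<open>The Young parameter \<open>(1 - \<rho>) / (2 \<rho>)\<close> splits the spectral gap in half.\<close>

lemma young_contraction:
  fixes a b :: "'a::real_inner"
  shows "\<rho> * (norm (a + b))\<^sup>2 \<le> (1 + \<rho>) / 2 * (norm a)\<^sup>2 + \<rho> * (1 + \<rho>) / (1 - \<rho>) * (norm b)\<^sup>2"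
proof -
  have "\<rho> * (norm (a + b))\<^sup>2 \<le> \<rho> * ((1 + (1 - \<rho>) / (2 * \<rho>)) * (norm a)\<^sup>2
      + (1 + 1 / ((1 - \<rho>) / (2 * \<rho>))) * (norm b)\<^sup>2)"
    using \<rho>_pos \<rho>_less_1 by (intro mult_left_mono norm_add_sq_le) auto
  also have "\<dots> = (1 + \<rho>) / 2 * (norm a)\<^sup>2 + \<rho> * (1 + \<rho>) / (1 - \<rho>) * (norm b)\<^sup>2"
    using \<rho>_pos \<rho>_less_1 by (simp add: field_simps)
  finally show ?thesis .
qed

lemma increment_second_moment:
  assumes "1 \<le> s" "s \<le> CARD('m)"
  shows "batch_mean s (\<lambda>A. (norm (increment s A x Z))\<^sup>2) \<le> (2 * grad_error (spread x) + 2 * grad_error Z) / real CARD('m)"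
proof -
  have "grad_stack f (spread x) - grad_stack f Z
      = (grad_stack f (spread x) - grad_stack f (stack xs)) - (grad_stack f Z - grad_stack f (stack xs))"
    by simp
  then have "(norm (grad_stack f (spread x) - grad_stack f Z))\<^sup>2 \<le> 2 * grad_error (spread x) + 2 * grad_error Z"
    using norm_diff_sq_le_2 by metis
  then have "(norm (grad_stack f (spread x) - grad_stack f Z))\<^sup>2 / real CARD('m) \<le> (2 * grad_error (spread x) + 2 * grad_error Z) / real CARD('m)"
    by (intro divide_right_mono) auto
  then show ?thesis
    using batch_mean_norm_sample_avg_sq_le[OF assms] unfolding increment_def by (rule order_trans[rotated])
qed

text \<open>By the invariant \<open>inv\<close>, the expectation of the mean direction is the mean gradient at \<open>x\<close>. The
  squared distance therefore splits into that of the deterministic gradient step and \<open>\<alpha>\<^sup>2\<close> times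
  the variance of the mean correction.\<close>

lemma mean_distance_drift:
  assumes s: "1 \<le> s" "s \<le> CARD('m)" and inv: "row_mean v = row_mean (device_mean (grad_stack f Z))"
  shows "batch_mean s (\<lambda>A. (norm (row_mean (x - \<alpha> *\<^sub>R (v + increment s A x Z)) - xs))\<^sup>2)
    \<le> (norm (row_mean x - xs))\<^sup>2 - 2 * \<alpha> * gap x + 2 * \<alpha> * L / real CARD('n) * (norm (center x))\<^sup>2
      + \<alpha>\<^sup>2 / (real CARD('n) * real CARD('m)) * (3 * grad_error (spread x) + 2 * grad_error Z)"
proof -
  let ?h = "\<lambda>A. increment s A x Z" and ?g = "mean_grad x"
  let ?Eh = "batch_mean s ?h"
  have mean: "?Eh = device_mean (grad_stack f (spread x)) - device_mean (grad_stack f Z)"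
    unfolding increment_def by (simp add: batch_mean_sample_avg[OF s] linear_diff[OF linear_device_mean])
  define c where "c = row_mean x - xs - \<alpha> *\<^sub>R ?g"
  define E where "E A = - \<alpha> *\<^sub>R (row_mean (?h A) - row_mean ?Eh)" for A
  have E0: "batch_mean s E = 0"
    using s(2) unfolding E_def
    by (simp add: batch_mean_scaleR batch_mean_diff batch_mean_const batch_mean_linear[OF linear_row_mean] del: scaleR_minus_left)
  have split: "row_mean (x - \<alpha> *\<^sub>R (v + ?h A)) - xs = c + E A" for A
    by (simp add: c_def E_def row_mean_diff row_mean_add row_mean_scaleR inv mean algebra_simps)
  have var: "batch_mean s (\<lambda>A. (norm (E A))\<^sup>2) \<le> \<alpha>\<^sup>2 / real CARD('n) * ((2 * grad_error (spread x) + 2 * grad_error Z) / real CARD('m))"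
  proof -
    have "batch_mean s (\<lambda>A. (norm (E A))\<^sup>2) = \<alpha>\<^sup>2 * batch_mean s (\<lambda>A. (norm (row_mean (?h A) - row_mean ?Eh))\<^sup>2)"
      by (simp add: E_def power_mult_distrib batch_mean_cmult)
    also have "\<dots> \<le> \<alpha>\<^sup>2 * batch_mean s (\<lambda>A. (norm (row_mean (?h A)))\<^sup>2)"
      using batch_variance_le[OF s(2), of "\<lambda>A. row_mean (?h A)"]
      by (intro mult_left_mono) (simp_all add: batch_mean_linear[OF linear_row_mean])
    also have "\<dots> \<le> \<alpha>\<^sup>2 * batch_mean s (\<lambda>A. (1 / real CARD('n)) * (norm (?h A))\<^sup>2)"
      using norm_row_mean_sq_le[of "?h _"]
      by (intro mult_left_mono batch_mean_mono) (simp_all add: field_simps)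
    also have "\<dots> = \<alpha>\<^sup>2 / real CARD('n) * batch_mean s (\<lambda>A. (norm (?h A))\<^sup>2)"
      by (simp only: batch_mean_cmult) simp
    also have "\<dots> \<le> \<alpha>\<^sup>2 / real CARD('n) * ((2 * grad_error (spread x) + 2 * grad_error Z) / real CARD('m))"
      by (intro mult_left_mono increment_second_moment[OF s]) simp
    finally show ?thesis .
  qed
  have "(norm c)\<^sup>2 = (norm (row_mean x - xs))\<^sup>2 - 2 * \<alpha> * (?g \<bullet> (row_mean x - xs)) + \<alpha>\<^sup>2 * (norm ?g)\<^sup>2"
    unfolding c_def power2_norm_eq_inner
    by (simp add: inner_diff_left inner_diff_right inner_commute power2_eq_square algebra_simps)
  also have "\<dots> \<le> (norm (row_mean x - xs))\<^sup>2 - 2 * \<alpha> * (gap x - L * (norm (center x))\<^sup>2 / real CARD('n))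
      + \<alpha>\<^sup>2 * (grad_error (spread x) / (real CARD('n) * real CARD('m)))"
    using mean_grad_descent[of x] norm_mean_grad_sq_le[of x] \<alpha>_pos
    by (intro add_mono diff_mono mult_left_mono) auto
  finally have "(norm c)\<^sup>2 + batch_mean s (\<lambda>A. (norm (E A))\<^sup>2)
      \<le> (norm (row_mean x - xs))\<^sup>2 - 2 * \<alpha> * (gap x - L * (norm (center x))\<^sup>2 / real CARD('n))
      + \<alpha>\<^sup>2 * (grad_error (spread x) / (real CARD('n) * real CARD('m))) + \<alpha>\<^sup>2 / real CARD('n) * ((2 * grad_error (spread x) + 2 * grad_error Z) / real CARD('m))"
    using var by linarith
  also have "\<dots> = (norm (row_mean x - xs))\<^sup>2 - 2 * \<alpha> * gap x + 2 * \<alpha> * L / real CARD('n) * (norm (center x))\<^sup>2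
      + \<alpha>\<^sup>2 / (real CARD('n) * real CARD('m)) * (3 * grad_error (spread x) + 2 * grad_error Z)"
    by (simp add: field_simps)
  finally show ?thesis
    unfolding split by (simp only: batch_mean_norm_sq_add[OF s(2) E0])
qed

text \<open>Both consensus errors after the step, already multiplied with the expected contraction \<open>\<rho>\<close>.
  The weight \<open>c4\<close> is just large enough that the part of the consensus error of \<open>v\<close> which leaks
  into \<open>x\<close> is compensated by the contraction of \<open>v\<close>.\<close>

lemma consensus_drift:
  assumes s: "1 \<le> s" "s \<le> CARD('m)"
  shows "batch_mean s (\<lambda>A. \<rho> * (c1 * (norm (center (x - \<alpha> *\<^sub>R (v + increment s A x Z))))\<^sup>2
      + c4 * (norm (center (v + (real s / real CARD('m)) *\<^sub>R increment s A x Z)))\<^sup>2))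
    \<le> c1 * (1 + \<rho>) / 2 * (norm (center x))\<^sup>2 + c4 * (norm (center v))\<^sup>2
      + 10 * \<alpha>\<^sup>2 / (real CARD('n) * real CARD('m) * (1 - \<rho>)\<^sup>2) * (grad_error (spread x) + grad_error Z)"
proof -
  let ?h = "\<lambda>A. increment s A x Z" and ?C = "(norm (center x))\<^sup>2" and ?B = "(norm (center v))\<^sup>2"
  define \<eta> where "\<eta> = 1 - \<rho>"
  have \<eta>: "0 < \<eta>" "\<eta> < 1" using \<rho>_pos \<rho>_less_1 by (auto simp: \<eta>_def)
  have n0: "0 < real CARD('n)" and m0: "0 < real CARD('m)" using n_pos m_pos by linarith+
  have c1_eq: "c1 * (\<rho> * (1 + \<rho>) / \<eta>) = 1 / (2 * real CARD('n))"
    using \<eta> \<rho>_pos n0 by (simp add: c1_def \<eta>_def divide_simps)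
  define H where "H = batch_mean s (\<lambda>A. (norm (?h A))\<^sup>2)"
  define G where "G = grad_error (spread x) + grad_error Z"
  have G0: "0 \<le> G" by (simp add: G_def)
  have H_le: "H \<le> 2 * G / real CARD('m)"
    using increment_second_moment[OF s, of x Z] by (simp add: H_def G_def)
  have cons: "\<rho> * (norm (center (x - \<alpha> *\<^sub>R (v + ?h A))))\<^sup>2
      \<le> (1 + \<rho>) / 2 * ?C + \<rho> * (1 + \<rho>) / \<eta> * (\<alpha>\<^sup>2 * (2 * ?B + 2 * (norm (?h A))\<^sup>2))" for A
  proof -
    have "(norm (center (v + ?h A)))\<^sup>2 \<le> 2 * ?B + 2 * (norm (center (?h A)))\<^sup>2"
      unfolding center_add by (rule norm_add_sq_le_2)
    also have "\<dots> \<le> 2 * ?B + 2 * (norm (?h A))\<^sup>2"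
      using norm_center_sq_le[of "?h A"] by simp
    finally have "(norm (- (\<alpha> *\<^sub>R center (v + ?h A))))\<^sup>2 \<le> \<alpha>\<^sup>2 * (2 * ?B + 2 * (norm (?h A))\<^sup>2)"
      by (simp add: power_mult_distrib mult_left_mono)
    then have "(1 + \<rho>) / 2 * ?C + \<rho> * (1 + \<rho>) / \<eta> * (norm (- (\<alpha> *\<^sub>R center (v + ?h A))))\<^sup>2
        \<le> (1 + \<rho>) / 2 * ?C + \<rho> * (1 + \<rho>) / \<eta> * (\<alpha>\<^sup>2 * (2 * ?B + 2 * (norm (?h A))\<^sup>2))"
      using \<rho>_pos \<eta> by (intro add_left_mono mult_left_mono) auto
    then show ?thesis
      using young_contraction[of "center x" "- (\<alpha> *\<^sub>R center (v + ?h A))"]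
      by (simp add: center_diff center_scaleR \<eta>_def)
  qed
  have track: "\<rho> * (norm (center (v + (real s / real CARD('m)) *\<^sub>R ?h A)))\<^sup>2 \<le> (1 + \<rho>) / 2 * ?B + 2 / \<eta> * (norm (?h A))\<^sup>2" for A
  proof -
    have "norm ((real s / real CARD('m)) *\<^sub>R center (?h A)) \<le> 1 * norm (center (?h A))"
      unfolding norm_scaleR using s by (intro mult_right_mono) auto
    then have "(norm ((real s / real CARD('m)) *\<^sub>R center (?h A)))\<^sup>2 \<le> (norm (center (?h A)))\<^sup>2"
      by (intro power_mono) auto
    also have "\<dots> \<le> (norm (?h A))\<^sup>2" by (rule norm_center_sq_le)
    finally have le: "(norm ((real s / real CARD('m)) *\<^sub>R center (?h A)))\<^sup>2 \<le> (norm (?h A))\<^sup>2" .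
    have "\<rho> * (1 + \<rho>) \<le> 1 * 2" using \<rho>_pos \<rho>_less_1 by (intro mult_mono) auto
    then have "\<rho> * (1 + \<rho>) / \<eta> * (norm ((real s / real CARD('m)) *\<^sub>R center (?h A)))\<^sup>2 \<le> 2 / \<eta> * (norm (?h A))\<^sup>2"
      using \<rho>_pos \<eta> by (intro mult_mono le divide_right_mono) auto
    then show ?thesis
      using young_contraction[of "center v" "(real s / real CARD('m)) *\<^sub>R center (?h A)"]
      by (simp only: center_add center_scaleR \<eta>_def[symmetric])
  qed
  have "batch_mean s (\<lambda>A. \<rho> * (c1 * (norm (center (x - \<alpha> *\<^sub>R (v + ?h A))))\<^sup>2
      + c4 * (norm (center (v + (real s / real CARD('m)) *\<^sub>R ?h A)))\<^sup>2))
    \<le> batch_mean s (\<lambda>A. (c1 * ((1 + \<rho>) / 2 * ?C + \<rho> * (1 + \<rho>) / \<eta> * (\<alpha>\<^sup>2 * (2 * ?B)))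
        + c4 * ((1 + \<rho>) / 2 * ?B)) + (c1 * (\<rho> * (1 + \<rho>) / \<eta> * (\<alpha>\<^sup>2 * 2)) + c4 * (2 / \<eta>)) * (norm (?h A))\<^sup>2)"
    (is "_ \<le> batch_mean s (\<lambda>A. ?c + ?d * _)")
  proof (rule batch_mean_mono)
    fix A :: "'n \<Rightarrow> 'm set"
    show "\<rho> * (c1 * (norm (center (x - \<alpha> *\<^sub>R (v + ?h A))))\<^sup>2
      + c4 * (norm (center (v + (real s / real CARD('m)) *\<^sub>R ?h A)))\<^sup>2) \<le> ?c + ?d * (norm (?h A))\<^sup>2"
      using mult_left_mono[OF cons[of A] c_nonneg(1)] mult_left_mono[OF track[of A] c_nonneg(3)]
      by (simp add: algebra_simps)
  qed
  also have "\<dots> = ?c + ?d * H"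
    by (simp add: batch_mean_add batch_mean_cmult batch_mean_const[OF s(2)] H_def)
  also have "?c = c1 * (1 + \<rho>) / 2 * ?C + c4 * ?B"
  proof -
    have "c4 * (1 - \<rho>) / 2 = \<alpha>\<^sup>2 / real CARD('n)"
      using \<eta> n0 by (simp add: c4_def \<eta>_def)
    moreover note c1_eq
    moreover have "?c = c1 * (1 + \<rho>) / 2 * ?C + c4 * ?B
        + (c1 * (\<rho> * (1 + \<rho>) / \<eta>) * \<alpha>\<^sup>2 * 2 - c4 * (1 - \<rho>) / 2) * ?B"
      by (simp add: field_simps)
    ultimately show ?thesis by simp
  qed
  also have "?d = \<alpha>\<^sup>2 / real CARD('n) * (1 + 4 / \<eta>\<^sup>2)"
  proof -
    have c4_eq: "c4 * (2 / \<eta>) = 4 * \<alpha>\<^sup>2 / (real CARD('n) * \<eta>\<^sup>2)"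
      by (simp add: c4_def \<eta>_def power2_eq_square)
    have "?d = c1 * (\<rho> * (1 + \<rho>) / \<eta>) * (2 * \<alpha>\<^sup>2) + c4 * (2 / \<eta>)" by simp
    then show ?thesis
      by (rule trans) (simp only: c1_eq c4_eq, simp add: distrib_left)
  qed
  also have "\<alpha>\<^sup>2 / real CARD('n) * (1 + 4 / \<eta>\<^sup>2) * H \<le> \<alpha>\<^sup>2 / real CARD('n) * (5 / \<eta>\<^sup>2) * (2 * G / real CARD('m))"
  proof -
    have "\<eta>\<^sup>2 \<le> 1" using \<eta> by (simp add: power_le_one)
    then have "1 + 4 / \<eta>\<^sup>2 \<le> 5 / \<eta>\<^sup>2" using \<eta> by (simp add: field_simps)
    then show ?thesis using H_le G0 m0 n0
      by (intro mult_mono mult_left_mono) (auto simp: H_def intro!: batch_mean_nonneg)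
  qed
  also have "\<alpha>\<^sup>2 / real CARD('n) * (5 / \<eta>\<^sup>2) * (2 * G / real CARD('m)) = 10 * \<alpha>\<^sup>2 / (real CARD('n) * real CARD('m) * (1 - \<rho>)\<^sup>2) * G"
    by (simp add: \<eta>_def mult_ac)
  finally show ?thesis by (simp add: G_def)
qed

text \<open>Every sample belongs to a batch of size \<open>s\<close> with probability \<open>s / m\<close>.\<close>

lemma refresh_drift:
  assumes s: "1 \<le> s" "s \<le> CARD('m)"
  shows "batch_mean s (\<lambda>A. grad_error (refresh A x Z))
    = grad_error Z + real s / real CARD('m) * (grad_error (spread x) - grad_error Z)"
proof -
  let ?e = "\<lambda>Z p. (norm ((grad_stack f Z - grad_stack f (stack xs)) $ p))\<^sup>2"
  have "grad_error (refresh A x Z) = (\<Sum>p\<in>UNIV. if snd p \<in> A (fst p) then ?e (spread x) p else ?e Z p)" for A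
    by (subst norm_rows_sq) (auto simp: grad_stack_def refresh_def intro!: sum.cong)
  then have "batch_mean s (\<lambda>A. grad_error (refresh A x Z))
      = real s / real CARD('m) * (\<Sum>p\<in>UNIV. ?e (spread x) p) + (1 - real s / real CARD('m)) * (\<Sum>p\<in>UNIV. ?e Z p)"
    by (simp only: batch_mean_sum_replaced[OF s])
  then show ?thesis unfolding norm_rows_sq[symmetric] by (simp add: algebra_simps)
qed

end

text \<open>One independent draw of a mixing matrix from the finite set \<open>Ws\<close> and of a batch size, with
  probabilities \<open>pw\<close> and \<open>pb\<close>; given its size, the batch is uniform.\<close>

locale spp_chain = spp_drift f xs L \<alpha> \<rho> q
  for f :: "'n::finite \<Rightarrow> 'm::finite \<Rightarrow> real^'d \<Rightarrow> real" and xs :: "real^'d" and L \<alpha> \<rho> q :: real +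
  fixes Ws :: "(real^'n^'n) set" and pw :: "real^'n^'n \<Rightarrow> real" and pb :: "nat \<Rightarrow> real"
  assumes pw_nonneg: "\<And>w. 0 \<le> pw w"
    and pw_stochastic: "\<And>w. w \<in> Ws \<Longrightarrow> pw w \<noteq> 0 \<Longrightarrow> doubly_stochastic w"
    and pw_sum: "(\<Sum>w\<in>Ws. pw w) = 1"
    and pw_contraction: "(\<Sum>w\<in>Ws. pw w * (spectral_norm (w - avg_mat))\<^sup>2) = \<rho>"
    and pb_nonneg: "\<And>s. 0 \<le> pb s"
    and pb_sum: "(\<Sum>s\<in>{1..CARD('m)}. pb s) = 1"
    and pb_mean: "(\<Sum>s\<in>{1..CARD('m)}. pb s * (real s / real CARD('m))) = q"
begin

definition step_mean :: "(real^'n^'n \<Rightarrow> nat \<Rightarrow> ('n \<Rightarrow> 'm set) \<Rightarrow> real) \<Rightarrow> real" where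
  "step_mean \<Phi> = (\<Sum>w\<in>Ws. pw w * (\<Sum>s\<in>{1..CARD('m)}. pb s * batch_mean s (\<Phi> w s)))"

lemma pb_affine:
  "(\<Sum>s\<in>{1..CARD('m)}. pb s * (c + d * g s)) = c * (\<Sum>s\<in>{1..CARD('m)}. pb s) + d * (\<Sum>s\<in>{1..CARD('m)}. pb s * g s)"
  by (simp add: distrib_left sum.distrib sum_distrib_left mult_ac)

text \<open>The mixing matrix is independent of the batch, and it enters the potential only through the
  squared spectral norm of its deviation from averaging, which may thus be replaced by its mean.\<close>

lemma step_mean_le:
  assumes bound: "\<And>(w :: real^'n^'n) s A. doubly_stochastic w \<Longrightarrow> 1 \<le> s \<Longrightarrow> s \<le> CARD('m) \<Longrightarrow> A \<in> batches s \<Longrightarrow>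
      \<Phi> w s A \<le> a s A + (spectral_norm (w - avg_mat))\<^sup>2 * d s A"
  shows "step_mean \<Phi> \<le> (\<Sum>s\<in>{1..CARD('m)}. pb s * batch_mean s (\<lambda>A. a s A + \<rho> * d s A))"
proof -
  let ?s = "\<lambda>w. (spectral_norm (w - avg_mat))\<^sup>2"
  let ?X = "\<Sum>s\<in>{1..CARD('m)}. pb s * batch_mean s (a s)" and ?Y = "\<Sum>s\<in>{1..CARD('m)}. pb s * batch_mean s (d s)"
  have affine: "(\<Sum>s\<in>{1..CARD('m)}. pb s * batch_mean s (\<lambda>A. a s A + k * d s A)) = ?X + k * ?Y" for k
    by (simp only: batch_mean_add batch_mean_cmult)
      (simp add: distrib_left sum.distrib sum_distrib_left mult_ac)
  have "step_mean \<Phi> \<le> (\<Sum>w\<in>Ws. pw w * (\<Sum>s\<in>{1..CARD('m)}. pb s * batch_mean s (\<lambda>A. a s A + ?s w * d s A)))"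
    unfolding step_mean_def
  proof (rule sum_mono)
    fix w assume w: "w \<in> Ws"
    show "pw w * (\<Sum>s\<in>{1..CARD('m)}. pb s * batch_mean s (\<Phi> w s))
        \<le> pw w * (\<Sum>s\<in>{1..CARD('m)}. pb s * batch_mean s (\<lambda>A. a s A + ?s w * d s A))"
    proof (cases "pw w = 0")
      case False
      then show ?thesis
        using pw_stochastic[OF w]
        by (intro mult_left_mono sum_mono batch_mean_mono bound pw_nonneg pb_nonneg) auto
    qed simp
  qed
  also have "\<dots> = (\<Sum>w\<in>Ws. pw w) * ?X + (\<Sum>w\<in>Ws. pw w * ?s w) * ?Y"
    unfolding affine by (simp add: distrib_left sum.distrib sum_distrib_right mult.assoc)
  also have "\<dots> = (\<Sum>s\<in>{1..CARD('m)}. pb s * batch_mean s (\<lambda>A. a s A + \<rho> * d s A))"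
    unfolding affine by (simp only: pw_sum pw_contraction mult_1)
  finally show ?thesis .
qed

text \<open>Write \<open>u = \<alpha>\<^sup>2 / (n m (1 - \<rho>)\<^sup>2)\<close>. The variance terms cost \<open>13 u\<close> times the gradient
  error at \<open>x\<close> and \<open>12 u\<close> times that at \<open>Z\<close>. Since \<open>c3 q = 20 u\<close>, refreshing removes
  the latter and adds \<open>20 u\<close> times the former. The resulting \<open>33 u\<close> times the gradient error at
  \<open>x\<close> costs the fraction \<open>66 \<alpha> L / (1 - \<rho>)\<^sup>2\<close> of the descent, plus a multiple of the
  consensus error of \<open>x\<close> that the step-size restriction lets the contraction of \<open>x\<close> absorb.\<close>

lemma potential_drift:
  assumes inv: "row_mean v = row_mean (device_mean (grad_stack f Z))"
  shows "step_mean (\<lambda>w s A. potential (step w s A (x, Z, v)))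
    \<le> potential (x, Z, v) - 2 * \<alpha> * (1 - 66 * \<alpha> * L / (1 - \<rho>)\<^sup>2) * gap x"
proof -
  let ?h = "\<lambda>s A. increment s A x Z" and ?M = "real CARD('n) * real CARD('m)"
  let ?C = "(norm (center x))\<^sup>2" and ?B = "(norm (center v))\<^sup>2"
    and ?D = "(norm (row_mean x - xs))\<^sup>2" and ?Q = "grad_error (spread x)" and ?A = "grad_error Z"
  define \<eta> where "\<eta> = 1 - \<rho>"
  have \<eta>: "0 < \<eta>" "\<eta> < 1" using \<rho>_pos \<rho>_less_1 by (auto simp: \<eta>_def)
  have \<eta>2: "\<eta>\<^sup>2 \<le> 1" using \<eta> by (simp add: power_le_one)
  define u where "u = \<alpha>\<^sup>2 / (?M * \<eta>\<^sup>2)"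
  have u0: "0 \<le> u" by (simp add: u_def)
  have "step_mean (\<lambda>w s A. potential (step w s A (x, Z, v)))
    \<le> (\<Sum>s\<in>{1..CARD('m)}. pb s * batch_mean s (\<lambda>A.
        ((norm (row_mean (x - \<alpha> *\<^sub>R (v + ?h s A)) - xs))\<^sup>2 + c3 * grad_error (refresh A x Z))
        + \<rho> * (c1 * (norm (center (x - \<alpha> *\<^sub>R (v + ?h s A))))\<^sup>2
           + c4 * (norm (center (v + (real s / real CARD('m)) *\<^sub>R ?h s A)))\<^sup>2)))"
  proof (rule step_mean_le)
    fix w :: "real^'n^'n" and s and A :: "'n \<Rightarrow> 'm set" assume w: "doubly_stochastic w"
    show "potential (step w s A (x, Z, v)) \<le>
      ((norm (row_mean (x - \<alpha> *\<^sub>R (v + ?h s A)) - xs))\<^sup>2 + c3 * grad_error (refresh A x Z))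
        + (spectral_norm (w - avg_mat))\<^sup>2 * (c1 * (norm (center (x - \<alpha> *\<^sub>R (v + ?h s A))))\<^sup>2
           + c4 * (norm (center (v + (real s / real CARD('m)) *\<^sub>R ?h s A)))\<^sup>2)"
      using mult_left_mono[OF norm_center_mult_sq_le[OF w, of "x - \<alpha> *\<^sub>R (v + ?h s A)"] c_nonneg(1)]
        mult_left_mono[OF norm_center_mult_sq_le[OF w, of "v + (real s / real CARD('m)) *\<^sub>R ?h s A"] c_nonneg(3)]
      by (simp add: row_mean_doubly_stochastic_mult[OF w] distrib_left mult_ac)
  qed
  also have "\<dots> \<le> (\<Sum>s\<in>{1..CARD('m)}. pb s *
      ((?D - 2 * \<alpha> * gap x + 2 * \<alpha> * L / real CARD('n) * ?C + c1 * (1 + \<rho>) / 2 * ?C + c4 * ?B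
        + u * (13 * ?Q + 12 * ?A) + c3 * ?A) + c3 * (?Q - ?A) * (real s / real CARD('m))))"
  proof (intro sum_mono mult_left_mono pb_nonneg)
    fix s assume "s \<in> {1..CARD('m)}"
    then have s: "1 \<le> s" "s \<le> CARD('m)" by auto
    have "\<alpha>\<^sup>2 / ?M \<le> u"
      using \<eta>2 \<eta> unfolding u_def by (intro divide_left_mono) (auto simp: mult_le_cancel_left1)
    then have "\<alpha>\<^sup>2 / ?M * (3 * ?Q + 2 * ?A) \<le> u * (3 * ?Q + 2 * ?A)"
      by (intro mult_right_mono) auto
    then have "batch_mean s (\<lambda>A. (norm (row_mean (x - \<alpha> *\<^sub>R (v + ?h s A)) - xs))\<^sup>2)
        \<le> ?D - 2 * \<alpha> * gap x + 2 * \<alpha> * L / real CARD('n) * ?C + u * (3 * ?Q + 2 * ?A)"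
      using mean_distance_drift[OF s inv, of x] by linarith
    moreover have "10 * \<alpha>\<^sup>2 / (?M * (1 - \<rho>)\<^sup>2) = 10 * u" by (simp add: u_def \<eta>_def)
    moreover have "batch_mean s (\<lambda>A. c3 * grad_error (refresh A x Z))
        = c3 * ?A + c3 * (?Q - ?A) * (real s / real CARD('m))"
      by (simp add: batch_mean_cmult refresh_drift[OF s] algebra_simps)
    ultimately show "batch_mean s (\<lambda>A.
        ((norm (row_mean (x - \<alpha> *\<^sub>R (v + ?h s A)) - xs))\<^sup>2 + c3 * grad_error (refresh A x Z))
        + \<rho> * (c1 * (norm (center (x - \<alpha> *\<^sub>R (v + ?h s A))))\<^sup>2
           + c4 * (norm (center (v + (real s / real CARD('m)) *\<^sub>R ?h s A)))\<^sup>2))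
      \<le> (?D - 2 * \<alpha> * gap x + 2 * \<alpha> * L / real CARD('n) * ?C + c1 * (1 + \<rho>) / 2 * ?C + c4 * ?B
        + u * (13 * ?Q + 12 * ?A) + c3 * ?A) + c3 * (?Q - ?A) * (real s / real CARD('m))"
      using consensus_drift[OF s, of x v Z] by (simp add: batch_mean_add distrib_left)
  qed
  also have "\<dots> = (?D - 2 * \<alpha> * gap x + 2 * \<alpha> * L / real CARD('n) * ?C + c1 * (1 + \<rho>) / 2 * ?C + c4 * ?B
        + u * (13 * ?Q + 12 * ?A) + c3 * ?A) * (\<Sum>s\<in>{1..CARD('m)}. pb s)
      + c3 * (?Q - ?A) * (\<Sum>s\<in>{1..CARD('m)}. pb s * (real s / real CARD('m)))"
    by (rule pb_affine)
  also have "\<dots> = ?D - 2 * \<alpha> * gap x + 2 * \<alpha> * L / real CARD('n) * ?C + c1 * (1 + \<rho>) / 2 * ?C + c4 * ?B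
        + u * (13 * ?Q + 12 * ?A) + c3 * ?A + c3 * q * (?Q - ?A)"
    by (simp only: pb_sum pb_mean) simp
  \<comment> \<open>the gradient error at \<open>Z\<close> now has the coefficient \<open>12 u - 20 u\<close>, hence drops out\<close>
  also have "c3 * q = 20 * u"
    using q_pos by (simp add: c3_def u_def \<eta>_def)
  also have "?D - 2 * \<alpha> * gap x + 2 * \<alpha> * L / real CARD('n) * ?C + c1 * (1 + \<rho>) / 2 * ?C + c4 * ?B
        + u * (13 * ?Q + 12 * ?A) + c3 * ?A + 20 * u * (?Q - ?A)
     \<le> potential (x, Z, v) - 2 * \<alpha> * gap x + 33 * (u * ?Q)
        + (2 * \<alpha> * L / real CARD('n) - c1 * \<eta> / 2) * ?C"
  proof -
    have "0 \<le> u * ?A" using u0 by simp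
    then show ?thesis by (simp add: \<eta>_def algebra_simps diff_divide_distrib add_divide_distrib)
  qed
  also have "u * ?Q \<le> (4 * (\<alpha> * L)\<^sup>2 / \<eta>\<^sup>2 / real CARD('n)) * ?C + 4 * \<alpha>\<^sup>2 * L / \<eta>\<^sup>2 * gap x"
  proof -
    have "u * ?Q \<le> u * (4 * L\<^sup>2 * real CARD('m) * ?C + 4 * L * real (CARD('n) * CARD('m)) * gap x)"
      by (intro mult_left_mono grad_error_spread_le u0)
    also have "u * (4 * L\<^sup>2 * real CARD('m) * ?C + 4 * L * real (CARD('n) * CARD('m)) * g)
        = (4 * (\<alpha> * L)\<^sup>2 / \<eta>\<^sup>2 / real CARD('n)) * ?C + 4 * \<alpha>\<^sup>2 * L / \<eta>\<^sup>2 * g" for g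
      using \<eta> by (simp add: u_def field_simps power2_eq_square)
    finally show ?thesis .
  qed
  also have "potential (x, Z, v) - 2 * \<alpha> * gap x
       + 33 * ((4 * (\<alpha> * L)\<^sup>2 / \<eta>\<^sup>2 / real CARD('n)) * ?C + 4 * \<alpha>\<^sup>2 * L / \<eta>\<^sup>2 * gap x)
       + (2 * \<alpha> * L / real CARD('n) - c1 * \<eta> / 2) * ?C
     = potential (x, Z, v) - 2 * \<alpha> * (1 - 66 * \<alpha> * L / \<eta>\<^sup>2) * gap x
       + (132 * ((\<alpha> * L)\<^sup>2 / \<eta>\<^sup>2) + 2 * (\<alpha> * L) - real CARD('n) * c1 * \<eta> / 2) / real CARD('n) * ?C"
    by (simp add: field_simps power2_eq_square)
  also have "\<dots> \<le> potential (x, Z, v) - 2 * \<alpha> * (1 - 66 * \<alpha> * L / \<eta>\<^sup>2) * gap x"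
  proof -
    have aL: "0 < \<alpha> * L" "1056 * (\<alpha> * L) \<le> \<eta>\<^sup>2"
      using \<alpha>_pos L_pos \<alpha>_le by (simp_all add: \<eta>_def)
    have "(\<alpha> * L)\<^sup>2 / \<eta>\<^sup>2 = (\<alpha> * L) * ((\<alpha> * L) / \<eta>\<^sup>2)" by (simp add: power2_eq_square)
    also have "\<dots> \<le> (\<alpha> * L) * (1 / 1056)"
      using aL \<eta> by (intro mult_left_mono) (auto simp: field_simps)
    finally have 1: "132 * ((\<alpha> * L)\<^sup>2 / \<eta>\<^sup>2) \<le> \<alpha> * L" using aL by linarith
    have "\<rho> * (1 + \<rho>) \<le> 1 * 2" using \<rho>_pos \<rho>_less_1 by (intro mult_mono) auto
    then have "\<eta>\<^sup>2 / 8 \<le> \<eta>\<^sup>2 / (4 * (\<rho> * (1 + \<rho>)))"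
      using \<rho>_pos by (intro divide_left_mono) auto
    also have "\<dots> = real CARD('n) * c1 * \<eta> / 2"
      by (simp add: c1_def \<eta>_def power2_eq_square)
    finally have "132 * ((\<alpha> * L)\<^sup>2 / \<eta>\<^sup>2) + 2 * (\<alpha> * L) - real CARD('n) * c1 * \<eta> / 2 \<le> 0"
      using 1 aL by linarith
    then have "(132 * ((\<alpha> * L)\<^sup>2 / \<eta>\<^sup>2) + 2 * (\<alpha> * L) - real CARD('n) * c1 * \<eta> / 2) / real CARD('n) * ?C \<le> 0"
      by (intro mult_nonpos_nonneg divide_nonpos_nonneg) auto
    then show ?thesis by linarith
  qed
  finally show ?thesis by (simp add: \<eta>_def)
qed

text \<open>The first direction is the mini-batch gradient \<open>sample_avg s A G\<close>, whose noise does not vanish at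
  the minimiser. Let \<open>S\<close> be the total variance of its rows. Since the devices sample
  independently, the mean row has variance
  \<open>S / n\<^sup>2\<close>, and the expected consensus error contains \<open>S - S / n\<close>. The latter is at
  least \<open>S / n\<close> for two or more devices, so the noise of the mean is paid for by the consensus
  error. This bounds the potential after one iteration by the Lyapunov terms at the start.\<close>

lemma first_step_drift:
  assumes n2: "2 \<le> CARD('n)" and G_def: "G = grad_stack f (stack x0)"
  shows "step_mean (\<lambda>w s A. potential (w ** (stack x0 - \<alpha> *\<^sub>R sample_avg s A G), stack x0, w ** device_mean G))
    \<le> (norm (x0 - xs))\<^sup>2 - 2 * \<alpha> * (1 - 66 * \<alpha> * L / (1 - \<rho>)\<^sup>2) * gap (stack x0) + c3 * grad_error (stack x0)
      + 4 * c4 * (\<Sum>s\<in>{1..CARD('m)}. pb s * batch_mean s (\<lambda>A. (norm (center (sample_avg s A G)))\<^sup>2))"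
proof -
  let ?y = "\<lambda>s A. sample_avg s A G" and ?u = "device_mean G" and ?g = "mean_grad (stack x0)" and ?n = "real CARD('n)"
  define \<eta> where "\<eta> = 1 - \<rho>"
  have \<eta>: "0 < \<eta>" "\<eta> < 1" using \<rho>_pos \<rho>_less_1 by (auto simp: \<eta>_def)
  have \<eta>2: "\<eta>\<^sup>2 \<le> 1" using \<eta> by (simp add: power_le_one)
  have center0: "center (stack z :: real^'d^'n) = 0" for z by (simp add: center_def)
  have g: "?g = row_mean ?u" by (simp add: G_def)
  let ?c = "(norm (x0 - xs))\<^sup>2 - 2 * \<alpha> * (1 - 66 * \<alpha> * L / \<eta>\<^sup>2) * gap (stack x0) + c3 * grad_error (stack x0)"
  have "step_mean (\<lambda>w s A. potential (w ** (stack x0 - \<alpha> *\<^sub>R ?y s A), stack x0, w ** ?u))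
    \<le> (\<Sum>s\<in>{1..CARD('m)}. pb s * batch_mean s (\<lambda>A.
        ((norm (x0 - \<alpha> *\<^sub>R row_mean (?y s A) - xs))\<^sup>2 + c3 * grad_error (stack x0))
        + \<rho> * (c1 * \<alpha>\<^sup>2 * (norm (center (?y s A)))\<^sup>2 + c4 * (norm (center ?u))\<^sup>2)))"
  proof (rule step_mean_le)
    fix w :: "real^'n^'n" and s and A :: "'n \<Rightarrow> 'm set" assume w: "doubly_stochastic w"
    have "(norm (center (w ** (stack x0 - \<alpha> *\<^sub>R ?y s A))))\<^sup>2
        \<le> (spectral_norm (w - avg_mat))\<^sup>2 * (\<alpha>\<^sup>2 * (norm (center (?y s A)))\<^sup>2)"
      using norm_center_mult_sq_le[OF w, of "stack x0 - \<alpha> *\<^sub>R ?y s A"]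
      by (simp add: center_diff center_scaleR center0 power_mult_distrib)
    from mult_left_mono[OF this c_nonneg(1)] mult_left_mono[OF norm_center_mult_sq_le[OF w, of ?u] c_nonneg(3)]
    show "potential (w ** (stack x0 - \<alpha> *\<^sub>R ?y s A), stack x0, w ** ?u)
      \<le> ((norm (x0 - \<alpha> *\<^sub>R row_mean (?y s A) - xs))\<^sup>2 + c3 * grad_error (stack x0))
        + (spectral_norm (w - avg_mat))\<^sup>2 * (c1 * \<alpha>\<^sup>2 * (norm (center (?y s A)))\<^sup>2 + c4 * (norm (center ?u))\<^sup>2)"
      by (simp add: row_mean_doubly_stochastic_mult[OF w] row_mean_diff row_mean_scaleR distrib_left mult_ac)
  qed
  also have "\<dots> \<le> (\<Sum>s\<in>{1..CARD('m)}. pb s * (?c + 4 * c4 * batch_mean s (\<lambda>A. (norm (center (?y s A)))\<^sup>2)))"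
  proof (intro sum_mono mult_left_mono pb_nonneg)
    fix s assume "s \<in> {1..CARD('m)}"
    then have s: "1 \<le> s" "s \<le> CARD('m)" by auto
    let ?e = "\<lambda>A. ?y s A - ?u"
    define S where "S = batch_mean s (\<lambda>A. (norm (?e A))\<^sup>2)"
    define B where "B = batch_mean s (\<lambda>A. (norm (center (?y s A)))\<^sup>2)"
    have S0: "0 \<le> S" by (simp add: S_def batch_mean_def sum_nonneg)
    have mean_e: "batch_mean s ?e = 0"
      by (simp add: batch_mean_diff batch_mean_const[OF s(2)] batch_mean_sample_avg[OF s])
    have "B = batch_mean s (\<lambda>A. (norm (center ?u + center (?e A)))\<^sup>2)"
      by (simp add: B_def center_diff)
    also have "\<dots> = (norm (center ?u))\<^sup>2 + batch_mean s (\<lambda>A. (norm (center (?e A)))\<^sup>2)"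
      by (rule batch_mean_norm_sq_add[OF s(2)])
        (simp add: batch_mean_linear[OF linear_center] mean_e linear_0[OF linear_center])
    also have "batch_mean s (\<lambda>A. (norm (center (?e A)))\<^sup>2) = S - ?n * (S / ?n\<^sup>2)"
      by (simp add: norm_center_sq batch_mean_diff batch_mean_cmult batch_variance_row_mean[OF s] S_def)
    finally have B: "B = (norm (center ?u))\<^sup>2 + S - S / ?n" by (simp add: power2_eq_square)
    have "S / ?n \<le> S / 2" using n2 S0 by (intro divide_left_mono) auto
    then have u_le: "(norm (center ?u))\<^sup>2 \<le> B" and S_le: "S / ?n \<le> B"
      using B S0 zero_le_power2[of "norm (center ?u)"] by linarith+
    have B0: "0 \<le> B" using u_le by (meson order_trans zero_le_power2)
    have "batch_mean s (\<lambda>A. (norm (x0 - \<alpha> *\<^sub>R row_mean (?y s A) - xs))\<^sup>2)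
        = batch_mean s (\<lambda>A. (norm ((x0 - xs - \<alpha> *\<^sub>R ?g) + (- \<alpha>) *\<^sub>R row_mean (?e A)))\<^sup>2)"
      unfolding g by (intro batch_mean_cong) (simp add: row_mean_diff algebra_simps)
    also have "\<dots> = (norm (x0 - xs - \<alpha> *\<^sub>R ?g))\<^sup>2 + batch_mean s (\<lambda>A. (norm ((- \<alpha>) *\<^sub>R row_mean (?e A)))\<^sup>2)"
      by (rule batch_mean_norm_sq_add[OF s(2)])
        (simp only: batch_mean_scaleR batch_mean_linear[OF linear_row_mean] mean_e linear_0[OF linear_row_mean] scaleR_zero_right)
    also have "batch_mean s (\<lambda>A. (norm ((- \<alpha>) *\<^sub>R row_mean (?e A)))\<^sup>2) = \<alpha>\<^sup>2 * (S / ?n\<^sup>2)"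
      by (simp only: norm_scaleR power_mult_distrib batch_mean_cmult batch_variance_row_mean[OF s] S_def) simp
    also have "\<dots> \<le> \<alpha>\<^sup>2 / ?n * B"
      using mult_left_mono[OF S_le, of "\<alpha>\<^sup>2 / ?n"] by (simp add: power2_eq_square)
    also have "(norm (x0 - xs - \<alpha> *\<^sub>R ?g))\<^sup>2
        = (norm (x0 - xs))\<^sup>2 - 2 * \<alpha> * (?g \<bullet> (x0 - xs)) + \<alpha>\<^sup>2 * (norm ?g)\<^sup>2"
      unfolding power2_norm_eq_inner
      by (simp add: inner_diff_left inner_diff_right inner_commute power2_eq_square algebra_simps)
    also have "\<dots> \<le> (norm (x0 - xs))\<^sup>2 - 2 * \<alpha> * gap (stack x0) + \<alpha>\<^sup>2 * (4 * L * gap (stack x0))"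
    proof -
      have "(norm ?g)\<^sup>2 \<le> 4 * L * real (CARD('n) * CARD('m)) * gap (stack x0) / real (CARD('n) * CARD('m))"
        using norm_mean_grad_sq_le[of "stack x0"] grad_error_spread_le[of "stack x0"]
        by (elim order_trans) (intro divide_right_mono, simp_all add: center0)
      then have "(norm ?g)\<^sup>2 \<le> 4 * L * gap (stack x0)" by simp
      moreover have "gap (stack x0) \<le> ?g \<bullet> (x0 - xs)"
        using mean_grad_descent[of "stack x0"] by (simp add: center0)
      ultimately show ?thesis using \<alpha>_pos by (intro add_mono diff_mono mult_left_mono) auto
    qed
    also have "(norm (x0 - xs))\<^sup>2 - 2 * \<alpha> * gap (stack x0) + \<alpha>\<^sup>2 * (4 * L * gap (stack x0))
        \<le> (norm (x0 - xs))\<^sup>2 - 2 * \<alpha> * (1 - 66 * \<alpha> * L / \<eta>\<^sup>2) * gap (stack x0)"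
    proof -
      have "2 * \<alpha> * L \<le> 66 * \<alpha> * L / \<eta>\<^sup>2"
        using \<alpha>_pos L_pos \<eta> \<eta>2 by (simp add: field_simps)
      then have "2 * \<alpha> * (1 - 66 * \<alpha> * L / \<eta>\<^sup>2) * gap (stack x0) \<le> 2 * \<alpha> * (1 - 2 * \<alpha> * L) * gap (stack x0)"
        using \<alpha>_pos argmin by (intro mult_right_mono mult_left_mono) auto
      then show ?thesis by (simp add: algebra_simps power2_eq_square)
    qed
    finally have dist: "batch_mean s (\<lambda>A. (norm (x0 - \<alpha> *\<^sub>R row_mean (?y s A) - xs))\<^sup>2)
        \<le> (norm (x0 - xs))\<^sup>2 - 2 * \<alpha> * (1 - 66 * \<alpha> * L / \<eta>\<^sup>2) * gap (stack x0) + \<alpha>\<^sup>2 / ?n * B"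
      by simp
    have c1_le: "\<rho> * c1 * \<alpha>\<^sup>2 \<le> c4"
    proof -
      have "\<rho> * c1 * \<alpha>\<^sup>2 = \<alpha>\<^sup>2 / ?n * (\<eta> / (2 * (1 + \<rho>)))"
        using \<rho>_pos by (simp add: c1_def \<eta>_def) (simp add: field_simps)
      also have "\<dots> \<le> \<alpha>\<^sup>2 / ?n * (2 / \<eta>)"
      proof (intro mult_left_mono)
        have "\<eta> * \<eta> \<le> 1" using \<eta>2 by (simp add: power2_eq_square)
        also have "1 \<le> 2 * (2 * (1 + \<rho>))" using \<rho>_pos by simp
        finally have "\<eta> * \<eta> \<le> 2 * (2 * (1 + \<rho>))" .
        then show "\<eta> / (2 * (1 + \<rho>)) \<le> 2 / \<eta>"
          using \<eta> \<rho>_pos by (simp add: frac_le_eq divide_le_eq pos_divide_le_eq pos_le_divide_eq)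
      qed simp
      finally show ?thesis by (simp add: c4_def \<eta>_def mult_ac)
    qed
    have \<alpha>_le_c4: "\<alpha>\<^sup>2 / ?n \<le> c4"
    proof -
      have "\<alpha>\<^sup>2 / ?n * 1 \<le> \<alpha>\<^sup>2 / ?n * (2 / \<eta>)"
        using \<eta> by (intro mult_left_mono) (auto simp: field_simps)
      then show ?thesis by (simp add: c4_def \<eta>_def mult_ac)
    qed
    have "\<rho> * c4 \<le> c4" using \<rho>_less_1 c_nonneg(3) \<rho>_pos by (simp add: mult_left_le_one_le)
    then have "\<rho> * c4 * (norm (center ?u))\<^sup>2 \<le> c4 * B"
      using u_le c_nonneg(3) by (intro mult_mono) auto
    moreover have "\<rho> * c1 * \<alpha>\<^sup>2 * B \<le> c4 * B" "\<alpha>\<^sup>2 / ?n * B \<le> c4 * B" "0 \<le> c4 * B"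
      using mult_right_mono[OF c1_le B0] mult_right_mono[OF \<alpha>_le_c4 B0] B0 c_nonneg(3) by simp_all
    ultimately have "batch_mean s (\<lambda>A. (norm (x0 - \<alpha> *\<^sub>R row_mean (?y s A) - xs))\<^sup>2) + c3 * grad_error (stack x0)
        + (\<rho> * c1 * \<alpha>\<^sup>2 * B + \<rho> * c4 * (norm (center ?u))\<^sup>2) \<le> ?c + 4 * (c4 * B)"
      using dist by linarith
    moreover have "batch_mean s (\<lambda>A. \<rho> * (c1 * \<alpha>\<^sup>2 * (norm (center (?y s A)))\<^sup>2 + c4 * (norm (center ?u))\<^sup>2))
      = \<rho> * c1 * \<alpha>\<^sup>2 * B + \<rho> * c4 * (norm (center ?u))\<^sup>2"
      by (simp add: B_def batch_mean_add batch_mean_cmult batch_mean_const[OF s(2)] distrib_left)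
    ultimately show "batch_mean s (\<lambda>A.
        ((norm (x0 - \<alpha> *\<^sub>R row_mean (?y s A) - xs))\<^sup>2 + c3 * grad_error (stack x0))
        + \<rho> * (c1 * \<alpha>\<^sup>2 * (norm (center (?y s A)))\<^sup>2 + c4 * (norm (center ?u))\<^sup>2))
      \<le> ?c + 4 * c4 * batch_mean s (\<lambda>A. (norm (center (?y s A)))\<^sup>2)"
      by (simp only: batch_mean_add batch_mean_const[OF s(2)] B_def[symmetric])
  qed
  also have "\<dots> = ?c * (\<Sum>s\<in>{1..CARD('m)}. pb s)
      + 4 * c4 * (\<Sum>s\<in>{1..CARD('m)}. pb s * batch_mean s (\<lambda>A. (norm (center (?y s A)))\<^sup>2))"
    by (rule pb_affine)
  finally show ?thesis by (simp only: pb_sum \<eta>_def mult_1_right)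
qed

end

section \<open>Finite-valued random variables with independent history\<close>

context prob_space
begin

text \<open>A function of a finite-valued variable is simple: it is the sum of its values times the
  indicators of the level sets.\<close>

lemma finite_valued:
  fixes H :: "'a \<Rightarrow> 'h" and \<phi> :: "'h \<Rightarrow> real"
  assumes V: "finite V" "\<And>\<omega>. \<omega> \<in> space M \<Longrightarrow> H \<omega> \<in> V"
    and ev: "\<And>v. v \<in> V \<Longrightarrow> {\<omega> \<in> space M. H \<omega> = v} \<in> events"
  shows integrable_finite_valued: "integrable M (\<lambda>\<omega>. \<phi> (H \<omega>))"
    and expectation_finite_valued:
      "expectation (\<lambda>\<omega>. \<phi> (H \<omega>)) = (\<Sum>v\<in>V. prob {\<omega> \<in> space M. H \<omega> = v} * \<phi> v)"
proof -
  let ?S = "\<lambda>\<omega>. \<Sum>v\<in>V. indicator {\<omega> \<in> space M. H \<omega> = v} \<omega> * \<phi> v"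
  have int: "integrable M (\<lambda>\<omega>. indicator {\<omega> \<in> space M. H \<omega> = v} \<omega> * \<phi> v)" if "v \<in> V" for v
    using ev[OF that] by (intro integrable_mult_left integrable_real_indicator) (auto simp: emeasure_eq_measure)
  have eq: "?S \<omega> = \<phi> (H \<omega>)" if "\<omega> \<in> space M" for \<omega>
  proof -
    have "?S \<omega> = (\<Sum>v\<in>V. if v = H \<omega> then \<phi> v else 0)"
      using that by (intro sum.cong) (auto simp: indicator_def)
    then show ?thesis using V that by simp
  qed
  have "integrable M ?S" by (intro Bochner_Integration.integrable_sum int)
  then show "integrable M (\<lambda>\<omega>. \<phi> (H \<omega>))"
    by (rule Bochner_Integration.integrable_cong[OF refl eq, THEN iffD1, rotated])
  have "expectation (\<lambda>\<omega>. \<phi> (H \<omega>)) = expectation ?S"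
    by (rule Bochner_Integration.integral_cong[OF refl eq[symmetric]])
  also have "\<dots> = (\<Sum>v\<in>V. expectation (\<lambda>\<omega>. indicator {\<omega> \<in> space M. H \<omega> = v} \<omega> * \<phi> v))"
    by (rule Bochner_Integration.integral_sum[OF int])
  also have "\<dots> = (\<Sum>v\<in>V. prob {\<omega> \<in> space M. H \<omega> = v} * \<phi> v)"
  proof (rule sum.cong[OF refl])
    fix v
    have "{\<omega> \<in> space M. H \<omega> = v} \<inter> space M = {\<omega> \<in> space M. H \<omega> = v}" by auto
    then show "expectation (\<lambda>\<omega>. indicator {\<omega> \<in> space M. H \<omega> = v} \<omega> * \<phi> v) = prob {\<omega> \<in> space M. H \<omega> = v} * \<phi> v"
      using Bochner_Integration.integral_indicator[of M "{\<omega> \<in> space M. H \<omega> = v}"] by simp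
  qed
  finally show "expectation (\<lambda>\<omega>. \<phi> (H \<omega>)) = (\<Sum>v\<in>V. prob {\<omega> \<in> space M. H \<omega> = v} * \<phi> v)" .
qed

end

definition history :: "(nat \<Rightarrow> 'w \<Rightarrow> 'c) \<Rightarrow> nat \<Rightarrow> 'w \<Rightarrow> 'c list" where
  "history \<xi> k \<omega> = map (\<lambda>j. \<xi> j \<omega>) [0..<k]"

lemma history_Suc: "history \<xi> (Suc k) \<omega> = history \<xi> k \<omega> @ [\<xi> k \<omega>]"
  by (simp add: history_def)

locale finite_independent_sequence = prob_space +
  fixes N :: "nat \<Rightarrow> 'c measure" and \<xi> :: "nat \<Rightarrow> 'a \<Rightarrow> 'c" and C :: "'c set"
  assumes indep: "indep_vars N \<xi> UNIV"
    and finite_C: "finite C"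
    and in_C: "\<And>k \<omega>. \<omega> \<in> space M \<Longrightarrow> \<xi> k \<omega> \<in> C"
    and singleton: "\<And>k c. c \<in> C \<Longrightarrow> {c} \<in> sets (N k)"
begin

lemma event_value: "c \<in> C \<Longrightarrow> {\<omega> \<in> space M. \<xi> k \<omega> = c} \<in> events"
  using indep measurable_sets[OF _ singleton, of "\<xi> k" M k c]
  by (auto simp: indep_vars_def2 vimage_def Int_def conj_commute)

abbreviation histories :: "nat \<Rightarrow> 'c list set" where
  "histories k \<equiv> {l. set l \<subseteq> C \<and> length l = k}"

lemma history_in: "\<omega> \<in> space M \<Longrightarrow> history \<xi> k \<omega> \<in> histories k"
  using in_C by (auto simp: history_def)

lemma history_eq_iff:
  "length l = k \<Longrightarrow> history \<xi> k \<omega> = l \<longleftrightarrow> (\<forall>j<k. \<xi> j \<omega> = l ! j)"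
  by (auto simp: history_def list_eq_iff_nth_eq)

lemma history_event:
  assumes "l \<in> histories k"
  shows "{\<omega> \<in> space M. history \<xi> k \<omega> = l} \<in> events"
proof -
  have "{\<omega> \<in> space M. \<forall>j\<in>{..<k}. \<xi> j \<omega> = l ! j} \<in> events"
    using assms by (intro sets.sets_Collect_finite_All event_value) auto
  moreover have "{\<omega> \<in> space M. \<forall>j\<in>{..<k}. \<xi> j \<omega> = l ! j} = {\<omega> \<in> space M. history \<xi> k \<omega> = l}"
    using assms history_eq_iff[of l k] by auto
  ultimately show ?thesis by simp
qed

lemma prob_history:
  assumes l: "l \<in> histories k"
  shows "prob {\<omega> \<in> space M. history \<xi> k \<omega> = l} = (\<Prod>j<k. prob {\<omega> \<in> space M. \<xi> j \<omega> = l ! j})"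
proof (cases "k = 0")
  case True
  then show ?thesis using l by (simp add: history_def prob_space)
next
  case False
  have "prob (\<Inter>j\<in>{..<k}. \<xi> j -` {l ! j} \<inter> space M) = (\<Prod>j<k. prob (\<xi> j -` {l ! j} \<inter> space M))"
    using l False by (intro indep_varsD[OF indep]) (auto intro!: singleton)
  moreover have "(\<Inter>j\<in>{..<k}. \<xi> j -` {l ! j} \<inter> space M) = {\<omega> \<in> space M. history \<xi> k \<omega> = l}"
    using l False by (auto simp: history_eq_iff)
  moreover have "\<xi> j -` {l ! j} \<inter> space M = {\<omega> \<in> space M. \<xi> j \<omega> = l ! j}" for j by auto
  ultimately show ?thesis by simp
qed

lemma finite_histories: "finite (histories k)"
  using finite_lists_length_eq[OF finite_C] by simp

lemma integrable_history: "integrable M (\<lambda>\<omega>. \<phi> (history \<xi> k \<omega>) :: real)"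
  by (rule integrable_finite_valued[OF finite_histories history_in history_event])

text \<open>Conditioning on the past: the current value is independent of the history, so it may be averaged
  out while the history stays in place. On joint values this is the product formula
  \<open>prob_history\<close> for histories of length \<open>k + 1\<close>.\<close>

lemma expectation_fresh:
  fixes F :: "'c list \<Rightarrow> 'c \<Rightarrow> real"
  shows "expectation (\<lambda>\<omega>. F (history \<xi> k \<omega>) (\<xi> k \<omega>))
    = expectation (\<lambda>\<omega>. \<Sum>c\<in>C. prob {\<omega> \<in> space M. \<xi> k \<omega> = c} * F (history \<xi> k \<omega>) c)"
proof -
  let ?p = "\<lambda>c. prob {\<omega> \<in> space M. \<xi> k \<omega> = c}" and ?P = "\<lambda>l. prob {\<omega> \<in> space M. history \<xi> k \<omega> = l}"
  have joint: "{\<omega> \<in> space M. (history \<xi> k \<omega>, \<xi> k \<omega>) = (l, c)} = {\<omega> \<in> space M. history \<xi> (Suc k) \<omega> = l @ [c]}" for l c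
    by (auto simp: history_Suc)
  have mem: "l @ [c] \<in> histories (Suc k)" if "(l, c) \<in> histories k \<times> C" for l c
    using that by auto
  have prod: "prob {\<omega> \<in> space M. (history \<xi> k \<omega>, \<xi> k \<omega>) = (l, c)} = ?P l * ?p c" if "(l, c) \<in> histories k \<times> C" for l c
  proof -
    have "prob {\<omega> \<in> space M. (history \<xi> k \<omega>, \<xi> k \<omega>) = (l, c)}
        = (\<Prod>j<Suc k. prob {\<omega> \<in> space M. \<xi> j \<omega> = (l @ [c]) ! j})"
      unfolding joint by (rule prob_history[OF mem[OF that]])
    also have "\<dots> = (\<Prod>j<k. prob {\<omega> \<in> space M. \<xi> j \<omega> = l ! j}) * ?p c"
      using that by (auto simp: nth_append intro!: prod.cong)
    finally show ?thesis using prob_history[of l k] that by simp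
  qed
  have "expectation (\<lambda>\<omega>. F (history \<xi> k \<omega>) (\<xi> k \<omega>))
      = expectation (\<lambda>\<omega>. (\<lambda>(l, c). F l c) (history \<xi> k \<omega>, \<xi> k \<omega>))"
    by simp
  also have "\<dots> = (\<Sum>v\<in>histories k \<times> C. prob {\<omega> \<in> space M. (history \<xi> k \<omega>, \<xi> k \<omega>) = v} * (\<lambda>(l, c). F l c) v)"
  proof (rule expectation_finite_valued)
    show "finite (histories k \<times> C)" using finite_histories finite_C by simp
    show "(history \<xi> k \<omega>, \<xi> k \<omega>) \<in> histories k \<times> C" if "\<omega> \<in> space M" for \<omega>
      using history_in[OF that] in_C[OF that] by simp
    show "{\<omega> \<in> space M. (history \<xi> k \<omega>, \<xi> k \<omega>) = v} \<in> events" if v: "v \<in> histories k \<times> C" for v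
    proof -
      obtain l c where lc: "v = (l, c)" by (cases v)
      show ?thesis
        using history_event[OF mem[OF v[unfolded lc]]] unfolding lc joint .
    qed
  qed
  also have "\<dots> = (\<Sum>(l, c)\<in>histories k \<times> C. ?P l * (?p c * F l c))"
  proof (rule sum.cong[OF refl])
    fix v assume v: "v \<in> histories k \<times> C"
    obtain l c where lc: "v = (l, c)" by (cases v)
    show "prob {\<omega> \<in> space M. (history \<xi> k \<omega>, \<xi> k \<omega>) = v} * (\<lambda>(l, c). F l c) v = (\<lambda>(l, c). ?P l * (?p c * F l c)) v"
      unfolding lc prod[OF v[unfolded lc]] by simp
  qed
  also have "\<dots> = (\<Sum>l\<in>histories k. ?P l * (\<Sum>c\<in>C. ?p c * F l c))"
    by (simp add: sum.cartesian_product[symmetric] sum_distrib_left)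
  also have "\<dots> = expectation (\<lambda>\<omega>. \<Sum>c\<in>C. ?p c * F (history \<xi> k \<omega>) c)"
    by (rule expectation_finite_valued[OF finite_histories history_in history_event, symmetric])
  finally show ?thesis .
qed

end

section \<open>The iteration as a Markov chain\<close>

lemma sel_mat_mult_nth:
  "(sel_mat A ** (Z :: real^'d^('n::finite \<times> 'm::finite))) $ p = (if snd p \<in> A (fst p) then Z $ p else 0)"
proof -
  have "(sel_mat A ** Z) $ p = (\<Sum>q\<in>UNIV. if p = q then (if snd p \<in> A (fst p) then Z $ p else 0) else 0)"
    unfolding matrix_mult_row by (intro sum.cong refl) (auto simp: sel_mat_def)
  then show ?thesis by simp
qed

lemma kron_mult_nth:
  "(kron w B ** (Z :: real^'d^('n::finite \<times> 'm::finite))) $ p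
    = (\<Sum>i\<in>UNIV. w $ fst p $ i *\<^sub>R (\<Sum>j\<in>UNIV. B $ snd p $ j *\<^sub>R Z $ (i, j)))"
  by (simp add: matrix_mult_row sum_UNIV_prod kron_def scaleR_sum_right)

lemma kron_avg_mult_nth:
  "(kron w avg_mat ** (Z :: real^'d^('n::finite \<times> 'm::finite))) $ p = (w ** device_mean Z) $ fst p"
  by (simp add: kron_mult_nth matrix_mult_row[of w] device_mean_nth avg_mat_def ones_mat_def scaleR_sum_right divide_inverse)

lemma spp_Gamma_mult_nth:
  "(spp_Gamma w s A A' ** (Z :: real^'d^('n::finite \<times> 'm::finite))) $ p
    = (if snd p \<in> A' (fst p) then (w ** sample_avg s A Z) $ fst p else 0)"
proof -
  have inner: "(((1 / real s) *\<^sub>R sel_mat A) ** Z) $ (i, j) = (if j \<in> A i then (1 / real s) *\<^sub>R Z $ (i, j) else 0)" for i j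
  proof -
    have "((1 / real s) *\<^sub>R sel_mat A) ** Z = (1 / real s) *\<^sub>R (sel_mat A ** Z)"
      by (simp add: vec_eq_iff matrix_matrix_mult_def sum_distrib_left)
    then show ?thesis by (simp add: sel_mat_mult_nth)
  qed
  have "(kron w ones_mat ** (((1 / real s) *\<^sub>R sel_mat A) ** Z)) $ p = (w ** sample_avg s A Z) $ fst p"
    unfolding kron_mult_nth inner matrix_mult_row[of w] sample_avg_nth
    by (simp add: ones_mat_def sum.If_cases scaleR_sum_right divide_inverse)
  then show ?thesis
    unfolding spp_Gamma_def by (simp add: matrix_mul_assoc[symmetric] sel_mat_mult_nth)
qed

lemma spp_R_mult_nth:
  "(spp_R w s A A' ** (Z :: real^'d^('n::finite \<times> 'm::finite))) $ p
    = (if snd p \<in> A' (fst p) then (w ** sample_avg s A Z) $ fst p else Z $ p)"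
proof -
  have "(B - B' + B'') ** Z = B ** Z - B' ** Z + B'' ** Z" for B B' B'' :: "real^('n \<times> 'm)^('n \<times> 'm)"
    by (simp add: vec_eq_iff matrix_matrix_mult_def algebra_simps sum.distrib sum_subtractf)
  then have "spp_R w s A A' ** Z = Z - sel_mat A' ** Z + spp_Gamma w s A A' ** Z"
    by (simp add: spp_R_def)
  then show ?thesis by (simp add: sel_mat_mult_nth spp_Gamma_mult_nth)
qed

text \<open>All selected rows of a device receive the same new value, and the other rows keep theirs.\<close>

lemma spp_step_refresh:
  fixes Z Y :: "real^'d^('n::finite \<times> 'm::finite)"
  shows "spp_R w s A A' ** Z - \<alpha> *\<^sub>R (spp_Gamma w s A A' ** Y)
    = refresh A' (w ** (sample_avg s A Z - \<alpha> *\<^sub>R sample_avg s A Y)) Z"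
proof -
  have "w ** (x - \<alpha> *\<^sub>R y) = w ** x - \<alpha> *\<^sub>R (w ** y)" for x y :: "real^'d^'n"
    by (simp add: vec_eq_iff matrix_matrix_mult_def algebra_simps sum_subtractf sum_distrib_left)
  then show ?thesis
    by (subst vec_eq_iff) (simp add: refresh_def spp_R_mult_nth spp_Gamma_mult_nth)
qed

lemma sample_avg_cong:
  fixes Z Z' :: "real^'d^('n::finite \<times> 'm::finite)"
  assumes "\<And>i j. j \<in> A i \<Longrightarrow> Z $ (i, j) = Z' $ (i, j)"
  shows "sample_avg s A Z = sample_avg s A Z'"
  by (subst vec_eq_iff) (simp add: sample_avg_nth assms)

lemma sample_avg_spread:
  fixes x :: "real^'d^'n::finite" and A :: "'n \<Rightarrow> 'm::finite set"
  assumes "1 \<le> s" "A \<in> batches s"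
  shows "sample_avg s A (spread x) = x"
  using assms by (subst vec_eq_iff) (simp add: sample_avg_nth batches_def sum_constant_scaleR del: sum_constant)

lemma sample_avg_refresh:
  assumes "1 \<le> s" "A \<in> batches s"
  shows "sample_avg s A (refresh A x Z) = x"
proof -
  have "sample_avg s A (refresh A x Z) = sample_avg s A (spread x)"
    by (rule sample_avg_cong) (simp add: refresh_def)
  then show ?thesis using assms by (simp add: sample_avg_spread)
qed

lemma device_mean_spread:
  fixes y :: "real^'d^'n::finite"
  shows "device_mean (spread y :: real^'d^('n \<times> 'm::finite)) = y"
  unfolding device_mean_def by (rule sample_avg_spread) (simp_all add: batches_def Suc_le_eq)

context spp_drift
begin

text \<open>On the batch the new points are the device points; off the batch the gradients have not changed.
  So the correction term can be read off the increment of the gradient stack, both sampled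
  and averaged over the whole device.\<close>

lemma increment_refresh:
  "sample_avg s A (grad_stack f (refresh A x Z) - grad_stack f Z) = increment s A x Z"
  unfolding increment_def by (rule sample_avg_cong) (simp add: refresh_def grad_stack_nth)

lemma device_mean_refresh:
  assumes "1 \<le> s"
  shows "device_mean (grad_stack f (refresh A x Z) - grad_stack f Z) = (real s / real CARD('m)) *\<^sub>R increment s A x Z"
proof -
  have "device_mean (grad_stack f (refresh A x Z) - grad_stack f Z) $ i
      = ((real s / real CARD('m)) *\<^sub>R increment s A x Z) $ i" for i
  proof -
    have "(\<Sum>j\<in>UNIV. (grad_stack f (refresh A x Z) - grad_stack f Z) $ (i, j))
        = (\<Sum>j\<in>UNIV. if j \<in> A i then (grad_stack f (spread x) - grad_stack f Z) $ (i, j) else 0)"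
      by (intro sum.cong refl) (simp add: refresh_def grad_stack_nth)
    also have "\<dots> = (\<Sum>j\<in>A i. (grad_stack f (spread x) - grad_stack f Z) $ (i, j))"
      by (simp add: sum.If_cases)
    finally show ?thesis using assms
      by (simp add: device_mean_nth increment_def sample_avg_nth divide_inverse del: vector_minus_component)
  qed
  then show ?thesis unfolding vec_eq_iff[of "device_mean _"] by blast
qed

end

text \<open>The random iteration. The numbers \<open>\<rho>\<close> and \<open>q\<close> of the drift analysis are tied to the draws by
  \<open>contraction\<close> and \<open>batch_fraction\<close>.\<close>

locale spp_process = prob_space P + spp_drift f xs L \<alpha> \<rho> q
  for P :: "'w measure" and f :: "'n::finite \<Rightarrow> 'm::finite \<Rightarrow> real^'d \<Rightarrow> real"
    and xs :: "real^'d" and L \<alpha> \<rho> q +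
  fixes x0 :: "real^'d" and W :: "real^'n^'n"
    and Wr Gr :: "nat \<Rightarrow> 'w \<Rightarrow> real^'n^'n"
    and Vr :: "nat \<Rightarrow> 'w \<Rightarrow> real^'m^'m"
    and b :: "nat \<Rightarrow> 'w \<Rightarrow> nat"
    and S :: "nat \<Rightarrow> 'w \<Rightarrow> 'n \<Rightarrow> 'm set"
    and X Y :: "nat \<Rightarrow> 'w \<Rightarrow> real^'d^('n \<times> 'm)"
  assumes batch_size: "\<And>k \<omega>. \<omega> \<in> space P \<Longrightarrow> 1 \<le> b k \<omega> \<and> b k \<omega> \<le> CARD('m)"
    and batch_card: "\<And>k \<omega> i. \<omega> \<in> space P \<Longrightarrow> card (S k \<omega> i) = b k \<omega>"
    and uniform: "\<And>k v s A. (\<And>i. card (A i) = s) \<Longrightarrow>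
      measure P {\<omega> \<in> space P. Vr k \<omega> = v \<and> b k \<omega> = s \<and> S k \<omega> = A} =
      measure P {\<omega> \<in> space P. Vr k \<omega> = v \<and> b k \<omega> = s} * (1 / real (CARD('m) choose s)) ^ CARD('n)"
    and Wr_values: "\<And>k \<omega>. \<omega> \<in> space P \<Longrightarrow> Wr k \<omega> \<in> {W, avg_mat}"
    and stochastic: "\<And>k \<omega>. \<omega> \<in> space P \<Longrightarrow> doubly_stochastic (Wr k \<omega>)"
    and indep_iter: "indep_vars
      (\<lambda>k. (borel \<Otimes>\<^sub>M borel) \<Otimes>\<^sub>M (borel \<Otimes>\<^sub>M count_space UNIV \<Otimes>\<^sub>M count_space UNIV))
      (\<lambda>k \<omega>. ((Wr k \<omega>, Gr k \<omega>), (Vr k \<omega>, b k \<omega>, S k \<omega>))) (UNIV :: nat set)"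
    and indep_step: "\<And>k. indep_set
      (sets (vimage_algebra (space P) (\<lambda>\<omega>. (Wr k \<omega>, Gr k \<omega>)) (borel \<Otimes>\<^sub>M borel)))
      (sets (vimage_algebra (space P) (\<lambda>\<omega>. (Vr k \<omega>, b k \<omega>, S k \<omega>))
         (borel \<Otimes>\<^sub>M count_space UNIV \<Otimes>\<^sub>M count_space UNIV)))"
    and contraction: "\<And>k. expectation (\<lambda>\<omega>. (spectral_norm (Wr k \<omega> - avg_mat))\<^sup>2) = \<rho>"
    and batch_fraction: "\<And>k. expectation (\<lambda>\<omega>. real (b k \<omega>) / real CARD('m)) = q"
    and Gr_eq: "\<And>k \<omega>. \<omega> \<in> space P \<Longrightarrow> Gr k \<omega> = Wr k \<omega>"
    and Vr_eq: "\<And>k \<omega>. \<omega> \<in> space P \<Longrightarrow> Vr k \<omega> = avg_mat"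
    and X_0: "\<And>\<omega>. \<omega> \<in> space P \<Longrightarrow> X 0 \<omega> = stack x0"
    and Y_0: "\<And>\<omega>. \<omega> \<in> space P \<Longrightarrow> Y 0 \<omega> = grad_stack f (X 0 \<omega>)"
    and step_X: "\<And>k \<omega>. \<omega> \<in> space P \<Longrightarrow> X (Suc k) \<omega> =
      spp_R (Wr k \<omega>) (b k \<omega>) (S k \<omega>) (S (Suc k) \<omega>) ** X k \<omega>
      - \<alpha> *\<^sub>R (spp_Gamma (Wr k \<omega>) (b k \<omega>) (S k \<omega>) (S (Suc k) \<omega>) ** Y k \<omega>)"
    and step_Y: "\<And>k \<omega>. \<omega> \<in> space P \<Longrightarrow> Y (Suc k) \<omega> =
      kron (Gr k \<omega>) (Vr k \<omega>) ** Y k \<omega> + grad_stack f (X (Suc k) \<omega>) - grad_stack f (X k \<omega>)"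
begin

lemma S_in_batches: "\<omega> \<in> space P \<Longrightarrow> S k \<omega> \<in> batches (b k \<omega>)"
  using batch_card by (simp add: batches_def)

abbreviation Xh :: "nat \<Rightarrow> 'w \<Rightarrow> real^'d^'n" where
  "Xh k \<omega> \<equiv> sample_avg (b k \<omega>) (S k \<omega>) (X k \<omega>)"

abbreviation Yh :: "nat \<Rightarrow> 'w \<Rightarrow> real^'d^'n" where
  "Yh k \<omega> \<equiv> sample_avg (b k \<omega>) (S k \<omega>) (Y k \<omega>)"

text \<open>For \<open>k \<ge> 1\<close>, the stored points before the batch of iteration \<open>k\<close> are \<open>X (k - 1)\<close>.\<close>

abbreviation fresh :: "nat \<Rightarrow> 'w \<Rightarrow> real^'d^'n" where
  "fresh k \<omega> \<equiv> increment (b k \<omega>) (S k \<omega>) (Xh k \<omega>) (X (k - 1) \<omega>)"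

text \<open>The chain is indexed such that \<open>state k\<close> depends on the draws \<open>0, \<dots>, k\<close>: the batch
  \<open>S (Suc k)\<close> does not influence the averages over it, by \<open>Xh_Suc\<close> below.\<close>

definition state :: "nat \<Rightarrow> 'w \<Rightarrow> ('d, 'n, 'm) spp_state" where
  "state k \<omega> = (Xh (Suc k) \<omega>, X k \<omega>, Wr k \<omega> ** device_mean (Y k \<omega>))"

context
  fixes \<omega> assumes \<omega>: "\<omega> \<in> space P"
begin

lemma X_Suc: "X (Suc k) \<omega> = refresh (S (Suc k) \<omega>) (Wr k \<omega> ** (Xh k \<omega> - \<alpha> *\<^sub>R Yh k \<omega>)) (X k \<omega>)"
  by (simp only: step_X[OF \<omega>] spp_step_refresh)

lemma Xh_Suc: "Xh (Suc k) \<omega> = Wr k \<omega> ** (Xh k \<omega> - \<alpha> *\<^sub>R Yh k \<omega>)"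
  using batch_size[OF \<omega>, of "Suc k"] S_in_batches[OF \<omega>]
  by (subst X_Suc) (simp add: sample_avg_refresh)

lemma X_Suc_refresh: "X (Suc k) \<omega> = refresh (S (Suc k) \<omega>) (Xh (Suc k) \<omega>) (X k \<omega>)"
  using X_Suc[of k] unfolding Xh_Suc[of k, symmetric] .

lemma Y_Suc: "Y (Suc k) \<omega> = spread (Wr k \<omega> ** device_mean (Y k \<omega>)) + (grad_stack f (X (Suc k) \<omega>) - grad_stack f (X k \<omega>))"
proof -
  have "kron (Gr k \<omega>) (Vr k \<omega>) ** Y k \<omega> = spread (Wr k \<omega> ** device_mean (Y k \<omega>))"
    using Gr_eq[OF \<omega>] Vr_eq[OF \<omega>] by (subst vec_eq_iff) (simp add: kron_avg_mult_nth)
  then show ?thesis by (simp add: step_Y[OF \<omega>])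
qed

lemma Yh_Suc: "Yh (Suc k) \<omega> = Wr k \<omega> ** device_mean (Y k \<omega>) + fresh (Suc k) \<omega>"
proof -
  have "sample_avg (b (Suc k) \<omega>) (S (Suc k) \<omega>) (grad_stack f (X (Suc k) \<omega>) - grad_stack f (X k \<omega>)) = fresh (Suc k) \<omega>"
    by (subst X_Suc_refresh) (simp add: increment_refresh)
  then show ?thesis
    using batch_size[OF \<omega>, of "Suc k"] S_in_batches[OF \<omega>, of "Suc k"]
    by (simp add: Y_Suc linear_add[OF linear_sample_avg] sample_avg_spread)
qed

lemma device_mean_Y_Suc:
  "device_mean (Y (Suc k) \<omega>) = Wr k \<omega> ** device_mean (Y k \<omega>) + (real (b (Suc k) \<omega>) / real CARD('m)) *\<^sub>R fresh (Suc k) \<omega>"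
proof -
  have "device_mean (grad_stack f (X (Suc k) \<omega>) - grad_stack f (X k \<omega>)) = (real (b (Suc k) \<omega>) / real CARD('m)) *\<^sub>R fresh (Suc k) \<omega>"
    using batch_size[OF \<omega>, of "Suc k"] by (subst X_Suc_refresh) (simp add: device_mean_refresh)
  then show ?thesis
    by (simp add: Y_Suc linear_add[OF linear_device_mean] device_mean_spread)
qed

lemma state_Suc: "state (Suc k) \<omega> = step (Wr (Suc k) \<omega>) (b (Suc k) \<omega>) (S (Suc k) \<omega>) (state k \<omega>)"
  using X_Suc_refresh[of k] Xh_Suc[of "Suc k"] Yh_Suc[of k] device_mean_Y_Suc[of k]
  by (simp add: state_def)

text \<open>The invariant of gradient tracking: mixing preserves the mean, and the increments telescope.\<close>

lemma row_mean_device_mean_Y: "row_mean (device_mean (Y k \<omega>)) = row_mean (device_mean (grad_stack f (X k \<omega>)))"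
proof (induction k)
  case 0
  show ?case by (simp add: Y_0[OF \<omega>])
next
  case (Suc k)
  then show ?case
    by (simp add: Y_Suc linear_add[OF linear_device_mean] linear_diff[OF linear_device_mean] device_mean_spread
        row_mean_add row_mean_diff row_mean_doubly_stochastic_mult[OF stochastic[OF \<omega>]])
qed

lemma Xh_0: "Xh 0 \<omega> = stack x0"
proof -
  have "Xh 0 \<omega> = sample_avg (b 0 \<omega>) (S 0 \<omega>) (spread (stack x0))"
    by (simp add: X_0[OF \<omega>])
  then show ?thesis
    using batch_size[OF \<omega>, of 0] S_in_batches[OF \<omega>, of 0] sample_avg_spread by metis
qed

lemma state_0:
  "state 0 \<omega> = (Wr 0 \<omega> ** (stack x0 - \<alpha> *\<^sub>R sample_avg (b 0 \<omega>) (S 0 \<omega>) (grad_stack f (stack x0))),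
     stack x0, Wr 0 \<omega> ** device_mean (grad_stack f (stack x0)))"
  by (simp add: state_def Xh_Suc Xh_0) (simp add: X_0[OF \<omega>] Y_0[OF \<omega>])

end

end

section \<open>Expectations along the chain\<close>

type_synonym ('n, 'm) spp_draw =
  "((real^'n^'n) \<times> (real^'n^'n)) \<times> (real^'m^'m) \<times> nat \<times> ('n \<Rightarrow> 'm set)"

context spp_process
begin

definition draw :: "nat \<Rightarrow> 'w \<Rightarrow> ('n, 'm) spp_draw" where
  "draw k \<omega> = ((Wr k \<omega>, Gr k \<omega>), (Vr k \<omega>, b k \<omega>, S k \<omega>))"

text \<open>The values that a draw can take: \<open>Gr\<close> repeats \<open>Wr\<close>, and \<open>Vr\<close> is always the averaging
  matrix, so a mixing matrix, a batch size and a batch determine the draw.\<close>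

definition outcome :: "(real^'n^'n) \<times> nat \<times> ('n \<Rightarrow> 'm set) \<Rightarrow> ('n, 'm) spp_draw" where
  "outcome = (\<lambda>(w, s, A). ((w, w), (avg_mat, s, A)))"

definition outcomes :: "('n, 'm) spp_draw set" where
  "outcomes = outcome ` ({W, avg_mat} \<times> {1..CARD('m)} \<times> UNIV)"

lemma draw_eq: "\<omega> \<in> space P \<Longrightarrow> draw k \<omega> = outcome (Wr k \<omega>, b k \<omega>, S k \<omega>)"
  by (simp add: draw_def outcome_def Gr_eq Vr_eq)

sublocale seq: finite_independent_sequence P
  "\<lambda>k. (borel \<Otimes>\<^sub>M borel) \<Otimes>\<^sub>M (borel \<Otimes>\<^sub>M count_space UNIV \<Otimes>\<^sub>M count_space UNIV)" draw outcomes
proof unfold_locales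
  show "indep_vars (\<lambda>k. (borel \<Otimes>\<^sub>M borel) \<Otimes>\<^sub>M (borel \<Otimes>\<^sub>M count_space UNIV \<Otimes>\<^sub>M count_space UNIV)) draw UNIV"
    using indep_iter by (simp only: draw_def[abs_def])
  show "finite outcomes" by (simp add: outcomes_def)
  show "draw k \<omega> \<in> outcomes" if "\<omega> \<in> space P" for k \<omega>
    using Wr_values[OF that, of k] batch_size[OF that, of k] that
    by (auto simp: draw_eq outcomes_def intro!: imageI)
  show "{c} \<in> sets ((borel \<Otimes>\<^sub>M borel) \<Otimes>\<^sub>M (borel \<Otimes>\<^sub>M count_space UNIV \<Otimes>\<^sub>M count_space UNIV))" if "c \<in> outcomes" for c
  proof -
    obtain u w v s A where c: "c = ((u, w), (v, s, A))" by (metis surj_pair)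
    have "({u} \<times> {w}) \<times> ({v} \<times> {s} \<times> {A}) \<in> sets ((borel \<Otimes>\<^sub>M borel) \<Otimes>\<^sub>M (borel \<Otimes>\<^sub>M count_space UNIV \<Otimes>\<^sub>M count_space UNIV))"
      by (intro pair_measureI) auto
    then show ?thesis by (simp add: c)
  qed
qed

definition pw :: "nat \<Rightarrow> real^'n^'n \<Rightarrow> real" where
  "pw k w = prob {\<omega> \<in> space P. Wr k \<omega> = w}"

definition pb :: "nat \<Rightarrow> nat \<Rightarrow> real" where
  "pb k s = prob {\<omega> \<in> space P. b k \<omega> = s}"

lemma Wr_event:
  "{\<omega> \<in> space P. Wr k \<omega> = w} \<in> sets (vimage_algebra (space P) (\<lambda>\<omega>. (Wr k \<omega>, Gr k \<omega>)) (borel \<Otimes>\<^sub>M borel))"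
proof -
  have "{w} \<times> (UNIV :: (real^'n^'n) set) \<in> sets (borel \<Otimes>\<^sub>M borel)"
    by (intro pair_measureI) auto
  from in_vimage_algebra[OF this, of "\<lambda>\<omega>. (Wr k \<omega>, Gr k \<omega>)" "space P"]
  show ?thesis by (simp add: vimage_def Int_def conj_commute)
qed

lemma b_S_event:
  "{\<omega> \<in> space P. b k \<omega> \<in> T \<and> S k \<omega> \<in> U} \<in> sets (vimage_algebra (space P) (\<lambda>\<omega>. (Vr k \<omega>, b k \<omega>, S k \<omega>))
         (borel \<Otimes>\<^sub>M count_space UNIV \<Otimes>\<^sub>M count_space UNIV))"
proof -
  have "(UNIV :: (real^'m^'m) set) \<times> T \<times> U \<in> sets (borel \<Otimes>\<^sub>M count_space UNIV \<Otimes>\<^sub>M count_space UNIV)"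
    by (intro pair_measureI) auto
  from in_vimage_algebra[OF this, of "\<lambda>\<omega>. (Vr k \<omega>, b k \<omega>, S k \<omega>)" "space P"]
  show ?thesis by (simp add: vimage_def Int_def conj_commute conj_left_commute)
qed

lemma Wr_value_event: "{\<omega> \<in> space P. Wr k \<omega> = w} \<in> events"
  by (rule indep_setD_ev1[OF indep_step[of k], THEN subsetD, OF Wr_event])

lemma b_value_event: "{\<omega> \<in> space P. b k \<omega> = s} \<in> events"
  using indep_setD_ev2[OF indep_step[of k], THEN subsetD, OF b_S_event[of k "{s}" UNIV]] by simp

lemma expectation_Wr: "expectation (\<lambda>\<omega>. \<phi> (Wr k \<omega>)) = (\<Sum>w\<in>{W, avg_mat}. pw k w * \<phi> w)"
  unfolding pw_def by (rule expectation_finite_valued) (simp_all add: Wr_value_event Wr_values[simplified])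

lemma expectation_b: "expectation (\<lambda>\<omega>. \<phi> (b k \<omega>)) = (\<Sum>s\<in>{1..CARD('m)}. pb k s * \<phi> s)"
  unfolding pb_def by (rule expectation_finite_valued) (simp_all add: b_value_event batch_size[simplified])

sublocale chain: spp_chain f xs L \<alpha> \<rho> q "{W, avg_mat}" "pw k" "pb k" for k
proof unfold_locales
  show "0 \<le> pw k w" for w by (simp add: pw_def)
  show "0 \<le> pb k s" for s by (simp add: pb_def)
  show "doubly_stochastic w" if "pw k w \<noteq> 0" for w
  proof -
    have "{\<omega> \<in> space P. Wr k \<omega> = w} \<noteq> {}" using that by (auto simp: pw_def simp del: Collect_empty_eq)
    then show ?thesis using stochastic by blast
  qed
  show "(\<Sum>w\<in>{W, avg_mat}. pw k w) = 1"
    using expectation_Wr[of "\<lambda>_. 1" k] by (simp add: prob_space)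
  show "(\<Sum>w\<in>{W, avg_mat}. pw k w * (spectral_norm (w - avg_mat))\<^sup>2) = \<rho>"
    using expectation_Wr[of "\<lambda>w. (spectral_norm (w - avg_mat))\<^sup>2" k] contraction[of k] by simp
  show "(\<Sum>s\<in>{1..CARD('m)}. pb k s) = 1"
    using expectation_b[of "\<lambda>_. 1" k] by (simp add: prob_space)
  show "(\<Sum>s\<in>{1..CARD('m)}. pb k s * (real s / real CARD('m))) = q"
    using expectation_b[of "\<lambda>s. real s / real CARD('m)" k] batch_fraction[of k] by simp
qed

lemma prob_draw:
  assumes "s \<le> CARD('m)"
  shows "prob {\<omega> \<in> space P. draw k \<omega> = outcome (w, s, A)}
    = pw k w * (pb k s * (if A \<in> batches s then 1 / real (card (batches s :: ('n \<Rightarrow> 'm set) set)) else 0))"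
proof -
  have "{\<omega> \<in> space P. draw k \<omega> = outcome (w, s, A)}
      = {\<omega> \<in> space P. Wr k \<omega> = w} \<inter> {\<omega> \<in> space P. b k \<omega> \<in> {s} \<and> S k \<omega> \<in> {A}}"
    by (auto simp: draw_def outcome_def Gr_eq Vr_eq)
  then have "prob {\<omega> \<in> space P. draw k \<omega> = outcome (w, s, A)}
      = pw k w * prob {\<omega> \<in> space P. b k \<omega> \<in> {s} \<and> S k \<omega> \<in> {A}}"
    unfolding pw_def by (simp only: indep_setD[OF indep_step[of k] Wr_event b_S_event])
  also have "prob {\<omega> \<in> space P. b k \<omega> \<in> {s} \<and> S k \<omega> \<in> {A}}
      = pb k s * (if A \<in> batches s then 1 / real (card (batches s :: ('n \<Rightarrow> 'm set) set)) else 0)"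
  proof (cases "A \<in> batches s")
    case True
    then have card_A: "card (A i) = s" for i by (simp add: batches_def)
    have "{\<omega> \<in> space P. b k \<omega> \<in> {s} \<and> S k \<omega> \<in> {A}} = {\<omega> \<in> space P. Vr k \<omega> = avg_mat \<and> b k \<omega> = s \<and> S k \<omega> = A}"
      using Vr_eq by auto
    moreover have "{\<omega> \<in> space P. Vr k \<omega> = avg_mat \<and> b k \<omega> = s} = {\<omega> \<in> space P. b k \<omega> = s}"
      using Vr_eq by auto
    ultimately show ?thesis
      using uniform[of A s k avg_mat] card_A True by (simp add: pb_def card_batches power_one_over)
  next
    case False
    then have "{\<omega> \<in> space P. b k \<omega> \<in> {s} \<and> S k \<omega> \<in> {A}} = {}"
      using S_in_batches by auto
    then show ?thesis using False by (simp only:) simp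
  qed
  finally show ?thesis .
qed

text \<open>The law of one draw, in the form of \<open>step_mean\<close>: the mixing matrix is independent of batch size
  and batch, and given its size the batch is uniform.\<close>

lemma sum_outcomes: "(\<Sum>c\<in>outcomes. prob {\<omega> \<in> space P. draw k \<omega> = c} * F c)
    = chain.step_mean k (\<lambda>w s A. F (outcome (w, s, A)))"
proof -
  let ?N = "\<lambda>s. real (card (batches s :: ('n \<Rightarrow> 'm set) set))"
  have "(\<Sum>c\<in>outcomes. prob {\<omega> \<in> space P. draw k \<omega> = c} * F c)
      = (\<Sum>(w, s, A)\<in>{W, avg_mat} \<times> {1..CARD('m)} \<times> UNIV.
          prob {\<omega> \<in> space P. draw k \<omega> = outcome (w, s, A)} * F (outcome (w, s, A)))"
    unfolding outcomes_def
    by (subst sum.reindex) (auto simp: inj_on_def outcome_def intro!: sum.cong)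
  also have "\<dots> = (\<Sum>(w, s, A)\<in>{W, avg_mat} \<times> {1..CARD('m)} \<times> UNIV.
      pw k w * (pb k s * (if A \<in> batches s then 1 / ?N s else 0)) * F (outcome (w, s, A)))"
    by (intro sum.cong refl) (auto simp: prob_draw)
  also have "\<dots> = (\<Sum>w\<in>{W, avg_mat}. \<Sum>s\<in>{1..CARD('m)}. \<Sum>A\<in>UNIV.
      pw k w * (pb k s * (if A \<in> batches s then 1 / ?N s else 0)) * F (outcome (w, s, A)))"
    by (simp only: sum.cartesian_product)
  also have "\<dots> = (\<Sum>w\<in>{W, avg_mat}. \<Sum>s\<in>{1..CARD('m)}. pw k w * (pb k s *
      batch_mean s (\<lambda>A. F (outcome (w, s, A)))))"
  proof (intro sum.cong refl)
    fix w s
    have "(\<Sum>A\<in>UNIV. pw k w * (pb k s * (if A \<in> batches s then 1 / ?N s else 0)) * F (outcome (w, s, A)))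
      = (\<Sum>A\<in>UNIV. if A \<in> batches s then pw k w * pb k s / ?N s * F (outcome (w, s, A)) else 0)"
      by (intro sum.cong) auto
    also have "\<dots> = (\<Sum>A\<in>batches s. pw k w * pb k s / ?N s * F (outcome (w, s, A)))"
      by (simp add: sum.If_cases)
    also have "\<dots> = pw k w * (pb k s * batch_mean s (\<lambda>A. F (outcome (w, s, A))))"
      by (simp add: batch_mean_def sum_distrib_left divide_inverse mult_ac)
    finally show "(\<Sum>A\<in>UNIV. pw k w * (pb k s * (if A \<in> batches s then 1 / ?N s else 0)) * F (outcome (w, s, A)))
      = pw k w * (pb k s * batch_mean s (\<lambda>A. F (outcome (w, s, A))))" .
  qed
  finally show ?thesis
    unfolding chain.step_mean_def by (simp only: sum_distrib_left)
qed

lemma expectation_step: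
  "expectation (\<lambda>\<omega>. F (history draw k \<omega>) (Wr k \<omega>) (b k \<omega>) (S k \<omega>))
    = expectation (\<lambda>\<omega>. chain.step_mean k (F (history draw k \<omega>)))"
proof -
  let ?F = "\<lambda>l c. F l (fst (fst c)) (fst (snd (snd c))) (snd (snd (snd c)))"
  have "expectation (\<lambda>\<omega>. ?F (history draw k \<omega>) (draw k \<omega>))
      = expectation (\<lambda>\<omega>. \<Sum>c\<in>outcomes. prob {\<omega> \<in> space P. draw k \<omega> = c} * ?F (history draw k \<omega>) c)"
    by (rule seq.expectation_fresh)
  then show ?thesis by (simp add: sum_outcomes) (simp add: draw_def outcome_def)
qed

lemma state_history: "\<exists>\<zeta>. \<forall>\<omega>\<in>space P. state k \<omega> = \<zeta> (history draw (Suc k) \<omega>)"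
proof (induction k)
  case 0
  let ?\<zeta> = "\<lambda>l. case last l of ((w, u), (v, s, A)) \<Rightarrow>
    (w ** (stack x0 - \<alpha> *\<^sub>R sample_avg s A (grad_stack f (stack x0))), stack x0, w ** device_mean (grad_stack f (stack x0)))"
  have "\<forall>\<omega>\<in>space P. state 0 \<omega> = ?\<zeta> (history draw (Suc 0) \<omega>)"
    by (simp add: history_def state_0 draw_def)
  then show ?case by (intro exI[of _ ?\<zeta>])
next
  case (Suc k)
  then obtain \<zeta> where \<zeta>: "\<forall>\<omega>\<in>space P. state k \<omega> = \<zeta> (history draw (Suc k) \<omega>)" ..
  let ?\<zeta> = "\<lambda>l. case last l of ((w, u), (v, s, A)) \<Rightarrow> step w s A (\<zeta> (butlast l))"
  have "\<forall>\<omega>\<in>space P. state (Suc k) \<omega> = ?\<zeta> (history draw (Suc (Suc k)) \<omega>)"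
    using \<zeta> by (simp add: history_Suc[of _ "Suc k"] state_Suc) (simp add: draw_def)
  then show ?case by (intro exI[of _ ?\<zeta>])
qed

abbreviation progress :: real where
  "progress \<equiv> 2 * \<alpha> * (1 - 66 * \<alpha> * L / (1 - \<rho>)\<^sup>2)"

lemma expected_potential_Suc:
  "expectation (\<lambda>\<omega>. potential (state (Suc k) \<omega>))
    \<le> expectation (\<lambda>\<omega>. potential (state k \<omega>)) - progress * expectation (\<lambda>\<omega>. gap (Xh (Suc k) \<omega>))"
proof -
  obtain \<zeta> where \<zeta>: "\<And>\<omega>. \<omega> \<in> space P \<Longrightarrow> state k \<omega> = \<zeta> (history draw (Suc k) \<omega>)"
    using state_history by blast
  let ?h = "history draw (Suc k)"
  have int: "integrable P (\<lambda>\<omega>. potential (\<zeta> (?h \<omega>)))" "integrable P (\<lambda>\<omega>. gap (fst (\<zeta> (?h \<omega>))))"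
    by (rule seq.integrable_history)+
  have gap: "gap (Xh (Suc k) \<omega>) = gap (fst (\<zeta> (?h \<omega>)))" if "\<omega> \<in> space P" for \<omega>
    using \<zeta>[OF that, symmetric] by (simp add: state_def)
  have "expectation (\<lambda>\<omega>. potential (state (Suc k) \<omega>))
      = expectation (\<lambda>\<omega>. potential (step (Wr (Suc k) \<omega>) (b (Suc k) \<omega>) (S (Suc k) \<omega>) (\<zeta> (?h \<omega>))))"
    by (intro Bochner_Integration.integral_cong refl) (simp add: state_Suc \<zeta>)
  also have "\<dots> = expectation (\<lambda>\<omega>. chain.step_mean (Suc k) (\<lambda>w s A. potential (step w s A (\<zeta> (?h \<omega>)))))"
    by (rule expectation_step[where F = "\<lambda>l w s A. potential (step w s A (\<zeta> l))"])
  also have "\<dots> \<le> expectation (\<lambda>\<omega>. potential (\<zeta> (?h \<omega>)) - progress * gap (fst (\<zeta> (?h \<omega>))))"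
  proof (rule integral_mono)
    show "integrable P (\<lambda>\<omega>. chain.step_mean (Suc k) (\<lambda>w s A. potential (step w s A (\<zeta> (?h \<omega>)))))"
      by (rule seq.integrable_history)
    show "integrable P (\<lambda>\<omega>. potential (\<zeta> (?h \<omega>)) - progress * gap (fst (\<zeta> (?h \<omega>))))"
      by (rule seq.integrable_history)
    fix \<omega> assume \<omega>: "\<omega> \<in> space P"
    have "row_mean (Wr k \<omega> ** device_mean (Y k \<omega>)) = row_mean (device_mean (grad_stack f (X k \<omega>)))"
      by (simp add: row_mean_doubly_stochastic_mult[OF stochastic[OF \<omega>]] row_mean_device_mean_Y[OF \<omega>])
    from chain.potential_drift[OF this, of "Suc k" "Xh (Suc k) \<omega>"]
    show "chain.step_mean (Suc k) (\<lambda>w s A. potential (step w s A (\<zeta> (?h \<omega>))))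
        \<le> potential (\<zeta> (?h \<omega>)) - progress * gap (fst (\<zeta> (?h \<omega>)))"
      unfolding \<zeta>[OF \<omega>, symmetric] state_def fst_conv .
  qed
  also have "\<dots> = expectation (\<lambda>\<omega>. potential (\<zeta> (?h \<omega>))) - progress * expectation (\<lambda>\<omega>. gap (fst (\<zeta> (?h \<omega>))))"
    using int by (simp only: Bochner_Integration.integral_diff integrable_mult_right integral_mult_right_zero)
  also have "expectation (\<lambda>\<omega>. potential (\<zeta> (?h \<omega>))) = expectation (\<lambda>\<omega>. potential (state k \<omega>))"
    by (intro Bochner_Integration.integral_cong refl) (simp add: \<zeta>)
  also have "expectation (\<lambda>\<omega>. gap (fst (\<zeta> (?h \<omega>)))) = expectation (\<lambda>\<omega>. gap (Xh (Suc k) \<omega>))"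
    by (intro Bochner_Integration.integral_cong refl) (simp add: gap)
  finally show ?thesis .
qed

text \<open>With a single device every doubly stochastic matrix is \<open>avg_mat\<close>, which contradicts \<open>\<rho> > 0\<close>.\<close>

lemma two_devices: "2 \<le> CARD('n)"
proof (rule ccontr)
  assume "\<not> 2 \<le> CARD('n)"
  moreover have "0 < CARD('n)" by simp
  ultimately have "CARD('n) = 1" by linarith
  then obtain i0 :: 'n where i0: "UNIV = {i0}" by (rule card_1_singletonE)
  have "w = avg_mat" if "doubly_stochastic w" for w :: "real^'n^'n"
  proof -
    have "i = i0" for i using i0 by blast
    moreover have "w $ i0 $ i0 = 1" using doubly_stochasticD(1)[OF that, of i0] unfolding i0 by simp
    ultimately have "w $ i $ j = 1" for i j by metis
    then show ?thesis by (simp add: vec_eq_iff avg_mat_def ones_mat_def i0)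
  qed
  then have "Wr 0 \<omega> = avg_mat" if "\<omega> \<in> space P" for \<omega>
    using stochastic[OF that] by blast
  then have "spectral_norm (Wr 0 \<omega> - avg_mat) = 0" if "\<omega> \<in> space P" for \<omega>
    using that by (simp add: spectral_norm_def onorm_eq_0)
  then have "expectation (\<lambda>\<omega>. (spectral_norm (Wr 0 \<omega> - avg_mat))\<^sup>2) = expectation (\<lambda>\<omega>. 0)"
    by (intro Bochner_Integration.integral_cong refl) simp
  then show False using contraction[of 0] \<rho>_pos by simp
qed

definition initial_potential :: real where
  "initial_potential = expectation (\<lambda>\<omega>. lyapunov 1 (2 * c1) c3 (4 * c4) f xs
     (\<lambda>k. X k \<omega>) (\<lambda>k. Y k \<omega>) (\<lambda>k. b k \<omega>) (\<lambda>k. S k \<omega>) 0)"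

lemma expected_potential_0:
  "expectation (\<lambda>\<omega>. potential (state 0 \<omega>)) \<le> initial_potential - progress * expectation (\<lambda>\<omega>. gap (Xh 0 \<omega>))"
proof -
  define G where "G = grad_stack f (stack x0 :: real^'d^('n \<times> 'm))"
  let ?V = "\<lambda>s A. (norm (center (sample_avg s A G)))\<^sup>2"
  let ?v = "\<Sum>s\<in>{1..CARD('m)}. pb 0 s * batch_mean s (?V s)"
  have "expectation (\<lambda>\<omega>. potential (state 0 \<omega>)) = expectation (\<lambda>\<omega>. potential
      (Wr 0 \<omega> ** (stack x0 - \<alpha> *\<^sub>R sample_avg (b 0 \<omega>) (S 0 \<omega>) G), stack x0, Wr 0 \<omega> ** device_mean G))"
    by (intro Bochner_Integration.integral_cong refl) (simp only: state_0 G_def)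
  also have "\<dots> = expectation (\<lambda>\<omega>. chain.step_mean 0 (\<lambda>w s A. potential
      (w ** (stack x0 - \<alpha> *\<^sub>R sample_avg s A G), stack x0, w ** device_mean G)))"
    by (rule expectation_step[where F = "\<lambda>l w s A. potential
      (w ** (stack x0 - \<alpha> *\<^sub>R sample_avg s A G), stack x0, w ** device_mean G)"])
  also have "\<dots> \<le> (norm (x0 - xs))\<^sup>2 - progress * gap (stack x0) + c3 * grad_error (stack x0) + 4 * c4 * ?v"
    using chain.first_step_drift[OF two_devices G_def, of 0] by (simp add: prob_space)
  finally have step: "expectation (\<lambda>\<omega>. potential (state 0 \<omega>))
    \<le> (norm (x0 - xs))\<^sup>2 - progress * gap (stack x0) + c3 * grad_error (stack x0) + 4 * c4 * ?v" .
  have "expectation (\<lambda>\<omega>. ?V (b 0 \<omega>) (S 0 \<omega>)) = expectation (\<lambda>\<omega>. chain.step_mean 0 (\<lambda>w. ?V))"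
    by (rule expectation_step[where F = "\<lambda>l w. ?V"])
  also have "\<dots> = (\<Sum>w\<in>{W, avg_mat}. pw 0 w) * ?v"
    by (simp only: chain.step_mean_def sum_distrib_right) (simp add: prob_space)
  finally have V: "expectation (\<lambda>\<omega>. ?V (b 0 \<omega>) (S 0 \<omega>)) = ?v"
    by (simp only: chain.pw_sum mult_1)
  have int: "integrable P (\<lambda>\<omega>. ?V (b 0 \<omega>) (S 0 \<omega>))"
  proof -
    have "integrable P (\<lambda>\<omega>. (\<lambda>c. ?V (fst (snd (snd c))) (snd (snd (snd c)))) (last (history draw (Suc 0) \<omega>)))"
      by (rule seq.integrable_history)
    then show ?thesis by (simp add: history_def draw_def)
  qed
  have "initial_potential = expectation (\<lambda>\<omega>. ((norm (x0 - xs))\<^sup>2 + c3 * grad_error (stack x0)) + 4 * c4 * ?V (b 0 \<omega>) (S 0 \<omega>))"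
    unfolding initial_potential_def
  proof (intro Bochner_Integration.integral_cong refl)
    fix \<omega> assume \<omega>: "\<omega> \<in> space P"
    show "lyapunov 1 (2 * c1) c3 (4 * c4) f xs (\<lambda>k. X k \<omega>) (\<lambda>k. Y k \<omega>) (\<lambda>k. b k \<omega>) (\<lambda>k. S k \<omega>) 0
        = ((norm (x0 - xs))\<^sup>2 + c3 * grad_error (stack x0)) + 4 * c4 * ?V (b 0 \<omega>) (S 0 \<omega>)"
      by (simp only: lyapunov_def Let_def Xh_0[OF \<omega>])
        (simp add: X_0[OF \<omega>] Y_0[OF \<omega>] G_def center_def)
  qed
  also have "\<dots> = (norm (x0 - xs))\<^sup>2 + c3 * grad_error (stack x0) + 4 * c4 * ?v"
    using int by (simp add: V prob_space)
  finally have "initial_potential = (norm (x0 - xs))\<^sup>2 + c3 * grad_error (stack x0) + 4 * c4 * ?v" .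
  moreover have "expectation (\<lambda>\<omega>. gap (Xh 0 \<omega>)) = gap (stack x0)"
  proof -
    have "expectation (\<lambda>\<omega>. gap (Xh 0 \<omega>)) = expectation (\<lambda>\<omega>. gap (stack x0))"
      by (intro Bochner_Integration.integral_cong refl) (simp only: Xh_0)
    then show ?thesis by (simp add: prob_space)
  qed
  ultimately show ?thesis using step by simp
qed

lemma sum_expected_gap_le:
  "progress * (\<Sum>k<K. expectation (\<lambda>\<omega>. gap (Xh k \<omega>))) \<le> initial_potential"
proof -
  have telescope: "progress * (\<Sum>k\<le>j. expectation (\<lambda>\<omega>. gap (Xh k \<omega>))) \<le> initial_potential - expectation (\<lambda>\<omega>. potential (state j \<omega>))" for j
  proof (induction j)
    case 0
    show ?case using expected_potential_0 by simp
  next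
    case (Suc j)
    then show ?case using expected_potential_Suc[of j] by (simp add: distrib_left)
  qed
  have nonneg: "0 \<le> expectation (\<lambda>\<omega>. potential (state j \<omega>))" for j
    by (rule Bochner_Integration.integral_nonneg) (simp add: state_def c_nonneg)
  show ?thesis
  proof (cases K)
    case 0
    have "0 \<le> initial_potential" unfolding initial_potential_def
      by (rule Bochner_Integration.integral_nonneg) (simp add: lyapunov_def Let_def c_nonneg)
    then show ?thesis using 0 by simp
  next
    case (Suc j)
    then show ?thesis using telescope[of j] nonneg[of j] by (simp add: lessThan_Suc_atMost)
  qed
qed

end


theorem theorem6:
  fixes P :: "'w measure"
    and f :: "'n::finite \<Rightarrow> 'm::finite \<Rightarrow> real^'d \<Rightarrow> real"
    and xs x0 :: "real^'d"
    and L \<alpha> \<sigma> \<zeta> r q \<rho>W \<rho> c0 c1 c3 c4 :: real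
    and W :: "real^'n^'n"
    and Wr Gr :: "nat \<Rightarrow> 'w \<Rightarrow> real^'n^'n"
    and Vr :: "nat \<Rightarrow> 'w \<Rightarrow> real^'m^'m"
    and b :: "nat \<Rightarrow> 'w \<Rightarrow> nat"
    and S :: "nat \<Rightarrow> 'w \<Rightarrow> 'n \<Rightarrow> 'm set"
    and X Y :: "nat \<Rightarrow> 'w \<Rightarrow> real^'d^('n \<times> 'm)"
    and K :: nat
  assumes P: "prob_space P"
    \<comment> \<open>objective\<close>
    and diff: "\<And>i j x. f i j differentiable (at x)"
    and argmin: "\<And>x. global_fun f xs \<le> global_fun f x"
    and L_pos: "0 < L"
    and convex: "\<And>i x x'. 0 \<le>
      (gradient (device_fun f i) x - gradient (device_fun f i) x') \<bullet> (x - x')"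
    and smooth: "\<And>i x x'.
      norm (gradient (device_fun f i) x - gradient (device_fun f i) x') \<le> L * norm (x - x')"
    and sigma: "0 < \<sigma>"
      "(1 / real (CARD('n) * CARD('m))) * (\<Sum>i\<in>UNIV. \<Sum>j\<in>UNIV.
         (norm (gradient (f i j) xs - gradient (device_fun f i) xs))\<^sup>2) \<le> \<sigma>"
    and zeta: "0 < \<zeta>"
      "(1 / real CARD('n)) * (\<Sum>i\<in>UNIV. (norm (gradient (device_fun f i) xs))\<^sup>2) \<le> \<zeta>"
    and expected_smooth: "\<And>i x x'.
      (1 / real CARD('m)) * (\<Sum>j\<in>UNIV. (norm (gradient (f i j) x - gradient (f i j) x'))\<^sup>2)
        \<le> 2 * L * (device_fun f i x - device_fun f i x'
                    - gradient (device_fun f i) x' \<bullet> (x - x'))"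
    \<comment> \<open>sampling: given the batch size, the devices choose independent uniform batches\<close>
    and batch: "\<And>k \<omega>. \<omega> \<in> space P \<Longrightarrow> 1 \<le> b k \<omega> \<and> b k \<omega> \<le> CARD('m)"
      "\<And>k \<omega> i. \<omega> \<in> space P \<Longrightarrow> card (S k \<omega> i) = b k \<omega>"
    and uniform: "\<And>k v s A. (\<And>i. card (A i) = s) \<Longrightarrow>
      measure P {\<omega> \<in> space P. Vr k \<omega> = v \<and> b k \<omega> = s \<and> S k \<omega> = A} =
      measure P {\<omega> \<in> space P. Vr k \<omega> = v \<and> b k \<omega> = s} * (1 / real (CARD('m) choose s)) ^ CARD('n)"
    \<comment> \<open>random matrices\<close>
    and nonneg: "\<And>k \<omega>. \<omega> \<in> space P \<Longrightarrow>
      nonneg_mat (Wr k \<omega>) \<and> nonneg_mat (Gr k \<omega>) \<and> nonneg_mat (Vr k \<omega>)"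
    and mat_values: "\<And>k \<omega>. \<omega> \<in> space P \<Longrightarrow>
      Wr k \<omega> \<in> {W, avg_mat} \<and> Gr k \<omega> \<in> {mat 1, Wr k \<omega>} \<and> Vr k \<omega> \<in> {mat 1, avg_mat}"
    and stochastic: "\<And>k \<omega>. \<omega> \<in> space P \<Longrightarrow> doubly_stochastic (Wr k \<omega>)"
    \<comment> \<open>independence over the iterations and within one iteration\<close>
    and indep_iter: "prob_space.indep_vars P
      (\<lambda>k. (borel \<Otimes>\<^sub>M borel) \<Otimes>\<^sub>M (borel \<Otimes>\<^sub>M count_space UNIV \<Otimes>\<^sub>M count_space UNIV))
      (\<lambda>k \<omega>. ((Wr k \<omega>, Gr k \<omega>), (Vr k \<omega>, b k \<omega>, S k \<omega>))) (UNIV :: nat set)"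
    and indep_step: "\<And>k. prob_space.indep_set P
      (sets (vimage_algebra (space P) (\<lambda>\<omega>. (Wr k \<omega>, Gr k \<omega>)) (borel \<Otimes>\<^sub>M borel)))
      (sets (vimage_algebra (space P) (\<lambda>\<omega>. (Vr k \<omega>, b k \<omega>, S k \<omega>))
         (borel \<Otimes>\<^sub>M count_space UNIV \<Otimes>\<^sub>M count_space UNIV)))"
    \<comment> \<open>constants\<close>
    and r: "\<And>k. measure P {\<omega> \<in> space P. Wr k \<omega> = avg_mat} = r"
    and q: "\<And>k. (\<integral>\<omega>. real (b k \<omega>) / real CARD('m)
                  \<partial>uniform_measure P {\<omega> \<in> space P. Vr k \<omega> = avg_mat}) = q"
    and \<rho>W: "\<rho>W = (spectral_norm (W - avg_mat))\<^sup>2"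
    and \<rho>: "\<And>k. (\<integral>\<omega>. (spectral_norm (Wr k \<omega> - avg_mat))\<^sup>2 \<partial>P) = \<rho>"
      "\<rho> = (1 - r) * \<rho>W" "\<rho> < 1" "0 < \<rho>"
    \<comment> \<open>the iteration, in the case \<open>C\<close> = Kronecker product of \<open>Wr k\<close> and \<open>avg_mat\<close>\<close>
    and case_GV: "\<And>k \<omega>. \<omega> \<in> space P \<Longrightarrow> Gr k \<omega> = Wr k \<omega> \<and> Vr k \<omega> = avg_mat"
    and init: "\<And>\<omega>. \<omega> \<in> space P \<Longrightarrow> X 0 \<omega> = stack x0"
      "\<And>\<omega>. \<omega> \<in> space P \<Longrightarrow> Y 0 \<omega> = grad_stack f (X 0 \<omega>)"
    and step_X: "\<And>k \<omega>. \<omega> \<in> space P \<Longrightarrow> X (Suc k) \<omega> =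
      spp_R (Wr k \<omega>) (b k \<omega>) (S k \<omega>) (S (Suc k) \<omega>) ** X k \<omega>
      - \<alpha> *\<^sub>R (spp_Gamma (Wr k \<omega>) (b k \<omega>) (S k \<omega>) (S (Suc k) \<omega>) ** Y k \<omega>)"
    and step_Y: "\<And>k \<omega>. \<omega> \<in> space P \<Longrightarrow> Y (Suc k) \<omega> =
      kron (Gr k \<omega>) (Vr k \<omega>) ** Y k \<omega> + grad_stack f (X (Suc k) \<omega>) - grad_stack f (X k \<omega>)"
    \<comment> \<open>Lyapunov coefficients and step size\<close>
    and c0: "c0 = 1"
    and c1: "c1 = (1 - \<rho>) / (real CARD('n) * \<rho> * (1 + \<rho>))"
    and c3: "c3 = 20 * \<alpha>\<^sup>2 / (real (CARD('n) * CARD('m)) * q * (1 - \<rho>)\<^sup>2)"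
    and c4: "c4 = 8 * \<alpha>\<^sup>2 / (real CARD('n) * (1 - \<rho>))"
    and step_size: "0 < \<alpha>"
      "\<alpha> \<le> Min {1 / (8 * L), (1 - \<rho>) / (4 * L * sqrt (2 * \<rho> * (1 + \<rho>))), (1 - \<rho>)\<^sup>2 / (1056 * L)}"
    and K: "1 \<le> K"
  shows "(1 / real K) * (\<Sum>k<K. \<integral>\<omega>.
           (global_fun f (row_mean (sample_avg (b k \<omega>) (S k \<omega>) (X k \<omega>))) - global_fun f xs) \<partial>P)
    \<le> (1 - \<rho>)\<^sup>2 / (2 * \<alpha> * ((1 - \<rho>)\<^sup>2 - (640 + 10 * (1 - \<rho>)\<^sup>2) * \<alpha> * L) * real K)
      * (\<integral>\<omega>. lyapunov c0 c1 c3 c4 f xs (\<lambda>k. X k \<omega>) (\<lambda>k. Y k \<omega>) (\<lambda>k. b k \<omega>) (\<lambda>k. S k \<omega>) 0 \<partial>P)"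
proof -
  interpret prob_space P by (rule P)
  define m :: real where "m = real CARD('m)"
  have m1: "1 \<le> m" by (simp add: m_def Suc_le_eq)
  have Vr_all: "{\<omega> \<in> space P. Vr k \<omega> = avg_mat} = space P" for k
    using case_GV by auto
  \<comment> \<open>\<open>Vr k = avg_mat\<close> holds surely, so conditioning on it leaves \<open>P\<close> unchanged\<close>
  have "uniform_measure P (space P) = P"
    by (rule measure_eqI) (auto simp: emeasure_uniform_measure emeasure_space_1 sets.sets_into_space Int_absorb1 divide_ennreal_def)
  then have fraction: "expectation (\<lambda>\<omega>. real (b k \<omega>) / m) = q" for k
    using q[of k] by (simp add: Vr_all m_def)
  have b_event: "b 0 \<in> measurable P (count_space UNIV)"
  proof -
    have "(\<lambda>\<omega>. ((Wr 0 \<omega>, Gr 0 \<omega>), (Vr 0 \<omega>, b 0 \<omega>, S 0 \<omega>)))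
        \<in> measurable P ((borel \<Otimes>\<^sub>M borel) \<Otimes>\<^sub>M (borel \<Otimes>\<^sub>M count_space UNIV \<Otimes>\<^sub>M count_space UNIV))"
      using indep_iter by (simp add: indep_vars_def2)
    from measurable_compose[OF this, of "\<lambda>c. fst (snd (snd c))" "count_space UNIV"]
    show ?thesis by simp
  qed
  \<comment> \<open>batches are nonempty, whence \<open>q \<ge> 1 / m\<close>\<close>
  have q_pos: "0 < q"
  proof -
    have "1 / m = expectation (\<lambda>\<omega>. 1 / m)" by (simp add: prob_space)
    also have "\<dots> \<le> expectation (\<lambda>\<omega>. real (b 0 \<omega>) / m)"
    proof (rule integral_mono)
      show "integrable P (\<lambda>\<omega>. real (b 0 \<omega>) / m)"
        using b_event batch(1)[of _ 0] m1
        by (intro integrable_const_bound[where B = 1]) (auto simp: m_def)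
      show "1 / m \<le> real (b 0 \<omega>) / m" if "\<omega> \<in> space P" for \<omega>
        using batch(1)[OF that, of 0] m1 by (intro divide_right_mono) auto
    qed simp
    finally have "1 / m \<le> q" unfolding fraction .
    moreover have "0 < 1 / m" using m1 by simp
    ultimately show ?thesis by linarith
  qed
  have \<rho>_gap: "0 < (1 - \<rho>)\<^sup>2" using \<rho>(3) by simp
  have \<alpha>_le: "1056 * (\<alpha> * L) \<le> (1 - \<rho>)\<^sup>2"
  proof -
    have "\<alpha> \<le> (1 - \<rho>)\<^sup>2 / (1056 * L)" using step_size(2) by simp
    then show ?thesis using L_pos by (simp add: field_simps)
  qed
  interpret process: spp_process P f xs L \<alpha> \<rho> q x0 W Wr Gr Vr b S X Y
    by unfold_locales
      (fact diff argmin L_pos smooth expected_smooth step_size(1) \<rho>(1) \<rho>(3) \<rho>(4) q_pos \<alpha>_le uniform stochastic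
          indep_iter indep_step fraction[unfolded m_def] init(1) init(2) step_X step_Y batch(1) batch(2)
        | use mat_values case_GV in blast)+
  define \<theta> where "\<theta> = (1 - \<rho>)\<^sup>2 - (640 + 10 * (1 - \<rho>)\<^sup>2) * \<alpha> * L"
  have \<theta>_pos: "0 < \<theta>"
  proof -
    have "(1 - \<rho>)\<^sup>2 * (\<alpha> * L) \<le> 1 * (\<alpha> * L)"
      using \<rho>(3,4) step_size(1) L_pos by (intro mult_right_mono) (auto simp: power_le_one)
    moreover have "0 < \<alpha> * L" using step_size(1) L_pos by simp
    ultimately show ?thesis using \<alpha>_le by (simp add: \<theta>_def algebra_simps)
  qed
  let ?gap = "\<lambda>k. \<integral>\<omega>. (global_fun f (row_mean (sample_avg (b k \<omega>) (S k \<omega>) (X k \<omega>))) - global_fun f xs) \<partial>P"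
  let ?T = "\<integral>\<omega>. lyapunov c0 c1 c3 c4 f xs (\<lambda>k. X k \<omega>) (\<lambda>k. Y k \<omega>) (\<lambda>k. b k \<omega>) (\<lambda>k. S k \<omega>) 0 \<partial>P"
  have gap_nonneg: "0 \<le> (\<Sum>k<K. ?gap k)"
    using argmin by (intro sum_nonneg Bochner_Integration.integral_nonneg) simp
  have T: "?T = process.initial_potential"
  proof -
    have double: "e / (real CARD('n) * \<rho> * (1 + \<rho>)) = 2 * (e / (2 * real CARD('n) * \<rho> * (1 + \<rho>)))" for e
      by simp
    have w1: "c1 = 2 * process.c1"
      unfolding c1 process.c1_def by (rule double)
    have w4: "c4 = 4 * process.c4" and w3: "c3 = process.c3"
      unfolding c3 c4 process.c3_def process.c4_def by simp_all
    show ?thesis unfolding process.initial_potential_def c0 w1 w3 w4 ..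
  qed
  \<comment> \<open>the claimed rate asks for less progress per step than the drift provides\<close>
  have "\<theta> / (1 - \<rho>)\<^sup>2 \<le> 1 - 66 * \<alpha> * L / (1 - \<rho>)\<^sup>2"
  proof -
    have "66 \<le> 640 + 10 * (1 - \<rho>)\<^sup>2" using \<rho>_gap by linarith
    then have "66 * (\<alpha> * L) \<le> (640 + 10 * (1 - \<rho>)\<^sup>2) * (\<alpha> * L)"
      using step_size(1) L_pos by (intro mult_right_mono) auto
    then have "\<theta> \<le> (1 - \<rho>)\<^sup>2 - 66 * \<alpha> * L"
      unfolding \<theta>_def mult.assoc by linarith
    then have "\<theta> / (1 - \<rho>)\<^sup>2 \<le> ((1 - \<rho>)\<^sup>2 - 66 * \<alpha> * L) / (1 - \<rho>)\<^sup>2"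
      using \<rho>_gap by (intro divide_right_mono) auto
    then show ?thesis using \<rho>_gap by (simp add: diff_divide_distrib)
  qed
  then have "2 * \<alpha> * (\<theta> / (1 - \<rho>)\<^sup>2) * (\<Sum>k<K. ?gap k) \<le> process.progress * (\<Sum>k<K. ?gap k)"
    using step_size(1) gap_nonneg by (intro mult_right_mono mult_left_mono) auto
  also have "\<dots> \<le> ?T" unfolding T by (rule process.sum_expected_gap_le)
  finally have "(\<Sum>k<K. ?gap k) \<le> (1 - \<rho>)\<^sup>2 / (2 * \<alpha> * \<theta>) * ?T"
    using \<theta>_pos \<rho>_gap step_size(1) by (simp add: field_simps)
  then have "(1 / real K) * (\<Sum>k<K. ?gap k) \<le> (1 / real K) * ((1 - \<rho>)\<^sup>2 / (2 * \<alpha> * \<theta>) * ?T)"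
    by (rule mult_left_mono) simp
  also have "\<dots> = (1 - \<rho>)\<^sup>2 / (2 * \<alpha> * \<theta> * real K) * ?T" by simp
  finally show ?thesis unfolding \<theta>_def .
qed

end
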